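(* Let $\rho\in(0,1)$ and $\nu\in\mathbb{R}$, and suppose $(\rho,\nu)\neq(1/\sqrt{2},\,\pi/2+n\pi)$ for every $n\in\mathbb{Z}$. Put $\rho_0=\sqrt{1-\rho^2}$ and $\alpha_0=\rho e^{i\nu}$. On $\ell^2(\mathbb{Z})\otimes\mathbb{C}^2$, with orthonormal bases $\{\lvert x\rangle : x\in\mathbb{Z}\}$ of $\ell^2(\mathbb{Z})$ and $\{\lvert 0\rangle,\lvert 1\rangle\}$ of $\mathbb{C}^2$, define the unitary operator \[ \begin{aligned} U=\sum_{x\in\mathbb{Z}}\Big[&\lvert x-1\rangle\langle x\rvert\otimes\big(\rho_0^2\lvert 1\rangle\langle 0\rvert+\rho_0\overline{\alpha_0}\lvert 1\rangle\langle 1\rvert\big)\\ &+\lvert x\rangle\langle x\rvert\otimes\big(-\alpha_0\rho_0\lvert 0\rangle\langle 0\rvert-(1-\rho_0^2)\lvert 0\rangle\langle 1\rvert-(1-\rho_0^2)\lvert 1\rangle\langle 0\rvert+\rho_0\overline{\alpha_0}\lvert 1\rangle\langle 1\rvert\big)\\ &+\lvert x+1\rangle\langle x\rvert\otimes\big(-\alpha_0\rho_0\lvert 0\rangle\langle 0\rvert+\rho_0^2\lvert 0\rangle\langle 1\rvert\big)\Big]. \end{aligned} \] Let $\alpha,\beta\in\mathbb{C}$ with $|\alpha|^2+|\beta|^2=1$, let $\lvert\Psi_0\rangle=\lvert 0\rangle\otimes(\alpha\lvert 0\rangle+\beta\lvert 1\rangle)$ and $\lvert\Psi_{t+1}\rangle=U\lvert\Psi_t\rangle$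 for $t=0,1,2,\ldots$, and let $X_t$ be the $\mathbb{Z}$-valued random variable with $\mathbb{P}(X_t=x)=\big\|(\langle x\rvert\otimes I)\lvert\Psi_t\rangle\big\|^2$. Define \[ \xi(x)=(\rho^2-x^2)(\rho_0^2-x^2)-\rho^2\rho_0^2(\cos^2\nu)\,x^2, \] \[ \eta_{\pm}(x)=1-\rho^2\rho_0^2(1+\sin^2\nu)-(1-\rho^2\rho_0^2\cos^2\nu)\,x^2\pm 2\rho\rho_0(\sin\nu)\sqrt{\xi(x)}, \] \[ \gamma(x)=1+\Big\{|\alpha|^2-|\beta|^2-\frac{2\rho_0}{\rho}\big(\Re(\alpha\overline{\beta})\cos\nu-\Im(\alpha\overline{\beta})\sin\nu\big)\Big\}x, \] \[ h^\ast=\frac12\Big\{\sqrt{(1+\rho\rho_0)^2-\rho^2\rho_0^2\sin^2\nu}-\sqrt{(1-\rho\rho_0)^2-\rho^2\rho_0^2\sin^2\nu}\Big\}, \] and let $I_{(-h^\ast,h^\ast)}$ be the indicator function of the interval $(-h^\ast,h^\ast)$. Then $X_t/t$ converges in distribution as $t\to\infty$; more precisely, for every real $x$, \[ \lim_{t\to\infty}\mathbb{P}\Big(\frac{X_t}{t}\le x\Big)=\int_{-\infty}^{x}\frac{\sqrt{\eta_+(y)}+\sqrt{\eta_-(y)}}{2\pi(1-y^2)\sqrt{\xi(y)}}\,\gamma(y)\,I_{(-h^\ast,h^\ast)}(y)\,dy. \]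
   Context: $\Re(z)$ and $\Im(z)$ denote the real and imaginary parts of a complex number $z$, and $i$ is the imaginary unit. $\lvert 0\rangle=(1,0)^T$, $\lvert 1\rangle=(0,1)^T$ in $\mathbb{C}^2$, and $\|\cdot\|$ is the Euclidean norm on $\mathbb{C}^2$; $(\langle x\rvert\otimes I)\lvert\Psi\rangle\in\mathbb{C}^2$ is the component of $\lvert\Psi\rangle$ at position $x$. *)

theory Defs
  imports "HOL-Analysis.Analysis"
begin

text \<open>States of the walk: functions from positions to C^2, where a vector
  a|0> + b|1> of C^2 is represented by the pair (a, b).\<close>
type_synonym qstate = "int \<Rightarrow> complex \<times> complex"

definition rho0 :: "real \<Rightarrow> real" where
  "rho0 \<rho> = sqrt (1 - \<rho>\<^sup>2)"

definition alpha0 :: "real \<Rightarrow> real \<Rightarrow> complex" where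
  "alpha0 \<rho> \<nu> = complex_of_real \<rho> * cis \<nu>"

text \<open>The three 2x2 coefficient matrices of U, acting on (a,b) = a|0> + b|1>.
  Coefficient of |x-1><x| : rho0^2 |1><0| + rho0 conj(alpha0) |1><1|.\<close>
definition coinA :: "real \<Rightarrow> real \<Rightarrow> complex \<times> complex \<Rightarrow> complex \<times> complex" where
  "coinA \<rho> \<nu> v = (let r0 = complex_of_real (rho0 \<rho>); a0 = alpha0 \<rho> \<nu> in
     (0, r0\<^sup>2 * fst v + r0 * cnj a0 * snd v))"

text \<open>Coefficient of |x><x| : -alpha0 rho0 |0><0| - (1-rho0^2)|0><1|
   - (1-rho0^2)|1><0| + rho0 conj(alpha0)|1><1|.\<close>
definition coinB :: "real \<Rightarrow> real \<Rightarrow> complex \<times> complex \<Rightarrow> complex \<times> complex" where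
  "coinB \<rho> \<nu> v = (let r0 = complex_of_real (rho0 \<rho>); a0 = alpha0 \<rho> \<nu> in
     (- a0 * r0 * fst v - (1 - r0\<^sup>2) * snd v,
      - (1 - r0\<^sup>2) * fst v + r0 * cnj a0 * snd v))"

text \<open>Coefficient of |x+1><x| : -alpha0 rho0 |0><0| + rho0^2 |0><1|.\<close>
definition coinC :: "real \<Rightarrow> real \<Rightarrow> complex \<times> complex \<Rightarrow> complex \<times> complex" where
  "coinC \<rho> \<nu> v = (let r0 = complex_of_real (rho0 \<rho>); a0 = alpha0 \<rho> \<nu> in
     (- a0 * r0 * fst v + r0\<^sup>2 * snd v, 0))"

definition Uop :: "real \<Rightarrow> real \<Rightarrow> qstate \<Rightarrow> qstate" where
  "Uop \<rho> \<nu> \<Psi> = (\<lambda>y. coinA \<rho> \<nu> (\<Psi> (y + 1)) + coinB \<rho> \<nu> (\<Psi> y) + coinC \<rho> \<nu> (\<Psi> (y - 1)))"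

definition psi0 :: "complex \<Rightarrow> complex \<Rightarrow> qstate" where
  "psi0 \<alpha> \<beta> = (\<lambda>y. if y = 0 then (\<alpha>, \<beta>) else (0, 0))"

primrec psi :: "real \<Rightarrow> real \<Rightarrow> complex \<Rightarrow> complex \<Rightarrow> nat \<Rightarrow> qstate" where
  "psi \<rho> \<nu> \<alpha> \<beta> 0 = psi0 \<alpha> \<beta>"
| "psi \<rho> \<nu> \<alpha> \<beta> (Suc t) = Uop \<rho> \<nu> (psi \<rho> \<nu> \<alpha> \<beta> t)"

definition prob_at :: "real \<Rightarrow> real \<Rightarrow> complex \<Rightarrow> complex \<Rightarrow> nat \<Rightarrow> int \<Rightarrow> real" where
  "prob_at \<rho> \<nu> \<alpha> \<beta> t x =
     (let v = psi \<rho> \<nu> \<alpha> \<beta> t x in (cmod (fst v))\<^sup>2 + (cmod (snd v))\<^sup>2)"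

definition cdf_scaled :: "real \<Rightarrow> real \<Rightarrow> complex \<Rightarrow> complex \<Rightarrow> nat \<Rightarrow> real \<Rightarrow> real" where
  "cdf_scaled \<rho> \<nu> \<alpha> \<beta> t x =
     infsum (prob_at \<rho> \<nu> \<alpha> \<beta> t) {y::int. real_of_int y / real t \<le> x}"

definition xi :: "real \<Rightarrow> real \<Rightarrow> real \<Rightarrow> real" where
  "xi \<rho> \<nu> x = (\<rho>\<^sup>2 - x\<^sup>2) * ((rho0 \<rho>)\<^sup>2 - x\<^sup>2) - \<rho>\<^sup>2 * (rho0 \<rho>)\<^sup>2 * (cos \<nu>)\<^sup>2 * x\<^sup>2"

definition eta_plus :: "real \<Rightarrow> real \<Rightarrow> real \<Rightarrow> real" where
  "eta_plus \<rho> \<nu> x = 1 - \<rho>\<^sup>2 * (rho0 \<rho>)\<^sup>2 * (1 + (sin \<nu>)\<^sup>2)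
     - (1 - \<rho>\<^sup>2 * (rho0 \<rho>)\<^sup>2 * (cos \<nu>)\<^sup>2) * x\<^sup>2
     + 2 * \<rho> * rho0 \<rho> * sin \<nu> * sqrt (xi \<rho> \<nu> x)"

definition eta_minus :: "real \<Rightarrow> real \<Rightarrow> real \<Rightarrow> real" where
  "eta_minus \<rho> \<nu> x = 1 - \<rho>\<^sup>2 * (rho0 \<rho>)\<^sup>2 * (1 + (sin \<nu>)\<^sup>2)
     - (1 - \<rho>\<^sup>2 * (rho0 \<rho>)\<^sup>2 * (cos \<nu>)\<^sup>2) * x\<^sup>2
     - 2 * \<rho> * rho0 \<rho> * sin \<nu> * sqrt (xi \<rho> \<nu> x)"

definition gamma_w :: "real \<Rightarrow> real \<Rightarrow> complex \<Rightarrow> complex \<Rightarrow> real \<Rightarrow> real" where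
  "gamma_w \<rho> \<nu> \<alpha> \<beta> x = 1 + ((cmod \<alpha>)\<^sup>2 - (cmod \<beta>)\<^sup>2
     - (2 * rho0 \<rho> / \<rho>) * (Re (\<alpha> * cnj \<beta>) * cos \<nu> - Im (\<alpha> * cnj \<beta>) * sin \<nu>)) * x"

definition hstar :: "real \<Rightarrow> real \<Rightarrow> real" where
  "hstar \<rho> \<nu> = (1/2) * (sqrt ((1 + \<rho> * rho0 \<rho>)\<^sup>2 - \<rho>\<^sup>2 * (rho0 \<rho>)\<^sup>2 * (sin \<nu>)\<^sup>2)
     - sqrt ((1 - \<rho> * rho0 \<rho>)\<^sup>2 - \<rho>\<^sup>2 * (rho0 \<rho>)\<^sup>2 * (sin \<nu>)\<^sup>2))"

definition limit_density :: "real \<Rightarrow> real \<Rightarrow> complex \<Rightarrow> complex \<Rightarrow> real \<Rightarrow> real" where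
  "limit_density \<rho> \<nu> \<alpha> \<beta> y =
     (sqrt (eta_plus \<rho> \<nu> y) + sqrt (eta_minus \<rho> \<nu> y))
       / (2 * pi * (1 - y\<^sup>2) * sqrt (xi \<rho> \<nu> y))
     * gamma_w \<rho> \<nu> \<alpha> \<beta> y
     * indicator {- hstar \<rho> \<nu> <..< hstar \<rho> \<nu>} y"

end

theory Submission
  imports Defs "HOL-Probability.Probability"
begin

text \<open>In momentum space the walk is multiplication by a unitary 2x2 matrix with determinant
  \<open>-1\<close> and eigenvalues \<open>\<i> cis (\<plusminus>phase k)\<close>, where
  \<open>cos (phase k) = \<rho> \<rho>\<^sub>0 (sin k - sin \<nu>)\<close>. The excluded parameters are exactly those for which the
  two bands touch; otherwise \<open>phase\<close> is smooth. By Parseval, the characteristic function of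
  \<open>X\<^sub>t / t\<close> at \<open>\<xi>\<close> is the average over \<open>k\<close> of the inner product of the Fourier transform of the
  state with its translate by \<open>\<xi> / t\<close>. Mixed terms vanish in the limit because the eigenvectors are
  orthogonal, and the diagonal ones give \<open>cis (\<mp>\<xi> vel k)\<close> with the group velocity
  \<open>vel = phase'\<close>. The reflection of \<open>k\<close> to \<open>\<pi> - k\<close> flips the velocity and combines the two
  spectral weights into \<open>\<gamma> (vel k)\<close>, so the limit law is the image under \<open>vel\<close> of
  \<open>\<gamma> (vel k) dk / 2\<pi>\<close>. On each of the two arcs on which \<open>vel\<close> is monotone,
  \<open>vel' = \<plusminus>sqrt \<xi> (vel) / sphase\<close> and \<open>sqrt \<eta>\<^sub>\<plusminus> (vel) = (1 - vel\<^sup>2) sphase\<close>, where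
  \<open>sphase = sin phase\<close>, which turns the image measure into the stated density. Levy's continuity theorem concludes.\<close>

subsection \<open>The dispersion relation\<close>

locale band =
  fixes p s :: real
  assumes p_pos: "0 < p" and p_le: "p \<le> 1/2" and s_le: "\<bar>s\<bar> \<le> 1"
    and gap: "p * (1 + \<bar>s\<bar>) < 1"
begin

definition phase :: "real \<Rightarrow> real" where
  "phase k = arccos (p * (sin k - s))"

definition sphase :: "real \<Rightarrow> real" where
  "sphase k = sqrt (1 - (p * (sin k - s))\<^sup>2)"

definition vel :: "real \<Rightarrow> real" where
  "vel k = - p * cos k / sphase k"

text \<open>Numerator of the derivative of \<open>vel\<close> as a polynomial in
  \<open>u = sin k\<close>, up to the factor \<open>p\<close>; its zero locates the turning points
  of the group velocity.\<close>

definition crit :: "real \<Rightarrow> real" where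
  "crit u = p\<^sup>2 * s * u\<^sup>2 + (1 - p\<^sup>2 * (1 + s\<^sup>2)) * u + p\<^sup>2 * s"

text \<open>Squaring \<open>vel k = x\<close> gives a quadratic equation in \<open>u = sin k\<close>
  whose discriminant is \<open>4 * p\<^sup>2 * disc x\<close>.\<close>

definition disc :: "real \<Rightarrow> real" where
  "disc x = (x\<^sup>2)\<^sup>2 - (1 + p\<^sup>2 * (1 - s\<^sup>2)) * x\<^sup>2 + p\<^sup>2"

definition branch :: "real \<Rightarrow> real" where
  "branch x = 1 - p\<^sup>2 * (1 + s\<^sup>2) - (1 - p\<^sup>2 * (1 - s\<^sup>2)) * x\<^sup>2 + 2 * p * s * sqrt (disc x)"

definition vmax :: "real" where
  "vmax = (1/2) * (sqrt ((1 + p)\<^sup>2 - p\<^sup>2 * s\<^sup>2) - sqrt ((1 - p)\<^sup>2 - p\<^sup>2 * s\<^sup>2))"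

definition push_density :: "real \<Rightarrow> real" where
  "push_density x = sqrt (branch x) / ((1 - x\<^sup>2) * sqrt (disc x)) * indicator {- vmax<..<vmax} x"

lemma gap_sq: "p\<^sup>2 * (1 + \<bar>s\<bar>)\<^sup>2 < 1"
proof -
  have "(p * (1 + \<bar>s\<bar>))\<^sup>2 < 1\<^sup>2"
    using gap p_pos by (intro power_strict_mono) auto
  then show ?thesis by (simp add: power_mult_distrib)
qed

text \<open>Strictness keeps the argument of \<open>arccos\<close> off its endpoints, where
  differentiability fails. This is the separation of the two bands, supplied by
  \<open>gap\<close>.\<close>

lemma abs_cos_phase: "\<bar>p * (sin k - s)\<bar> < 1"
proof -
  have "\<bar>sin k - s\<bar> \<le> 1 + \<bar>s\<bar>" using abs_sin_le_one[of k] by linarith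
  then have "p * \<bar>sin k - s\<bar> \<le> p * (1 + \<bar>s\<bar>)" using p_pos by (intro mult_left_mono) auto
  then have "p * \<bar>sin k - s\<bar> < 1" using gap by linarith
  then show ?thesis using p_pos by (simp add: abs_mult)
qed

lemma one_minus_pos: "0 < 1 - (p * (sin k - s))\<^sup>2"
  using abs_cos_phase[of k] by (simp add: abs_square_less_1)

lemma sphase_pos: "0 < sphase k"
  using one_minus_pos by (simp add: sphase_def)

lemma sphase_sq: "(sphase k)\<^sup>2 = 1 - (p * (sin k - s))\<^sup>2"
  using one_minus_pos[of k] by (simp add: sphase_def)

lemma cos_phase: "cos (phase k) = p * (sin k - s)"
  using abs_cos_phase[of k] unfolding phase_def by (intro cos_arccos) auto

lemma sin_phase: "sin (phase k) = sphase k"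
  using abs_cos_phase[of k] unfolding phase_def sphase_def by (intro sin_arccos) auto

lemma phase_deriv: "(phase has_real_derivative vel k) (at k)"
proof -
  have *: "((\<lambda>k. arccos (p * (sin k - s))) has_real_derivative
      inverse (- sqrt (1 - (p * (sin k - s))\<^sup>2)) * (p * cos k)) (at k)"
    using abs_cos_phase[of k]
    by (intro DERIV_chain2[OF DERIV_arccos] derivative_eq_intros refl) auto
  have "phase = (\<lambda>k. arccos (p * (sin k - s)))" by (simp add: phase_def fun_eq_iff)
  then show ?thesis using * by (simp add: vel_def sphase_def field_simps)
qed

lemma sphase_deriv: "(sphase has_real_derivative - (p\<^sup>2 * (sin k - s) * cos k / sphase k)) (at k)"
proof -
  have *: "((\<lambda>k. sqrt (1 - (p * (sin k - s))\<^sup>2)) has_real_derivative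
      inverse (sqrt (1 - (p * (sin k - s))\<^sup>2)) / 2 * (- (2 * (p * (sin k - s)) * (p * cos k)))) (at k)"
    using one_minus_pos[of k]
    by (intro DERIV_chain2[OF DERIV_real_sqrt] derivative_eq_intros refl) auto
  have "sphase = (\<lambda>k. sqrt (1 - (p * (sin k - s))\<^sup>2))" by (simp add: sphase_def fun_eq_iff)
  moreover have "inverse (sphase k) / 2 * (- (2 * (p * (sin k - s)) * (p * cos k)))
      = - (p\<^sup>2 * (sin k - s) * cos k / sphase k)"
    using sphase_pos[of k] by (simp add: divide_simps power2_eq_square)
  ultimately show ?thesis using * by (simp add: sphase_def)
qed

lemma vel_deriv: "(vel has_real_derivative p * crit (sin k) / (sphase k) ^ 3) (at k)"
proof -
  have *: "((\<lambda>k. - p * cos k / sphase k) has_real_derivative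
     ((- p * - sin k) * sphase k - (- p * cos k) * (- (p\<^sup>2 * (sin k - s) * cos k / sphase k)))
       / (sphase k * sphase k)) (at k)"
    using sphase_pos[of k]
    by (intro DERIV_divide sphase_deriv derivative_eq_intros refl) auto
  let ?D = "sphase k" and ?u = "sin k"
  have "((- p * - sin k) * ?D - (- p * cos k) * (- (p\<^sup>2 * (sin k - s) * cos k / ?D)))
       / (?D * ?D) = p * (?u * ?D\<^sup>2 - p\<^sup>2 * (?u - s) * (cos k)\<^sup>2) / ?D ^ 3"
    using sphase_pos[of k] by (simp add: field_simps power2_eq_square power3_eq_cube)
  also have "?u * ?D\<^sup>2 - p\<^sup>2 * (?u - s) * (cos k)\<^sup>2 = crit ?u"
    unfolding sphase_sq cos_squared_eq crit_def by (simp add: algebra_simps power2_eq_square)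
  moreover have "vel = (\<lambda>k. - p * cos k / sphase k)" by (simp add: vel_def fun_eq_iff)
  ultimately show ?thesis using * by simp
qed

lemma continuous_on_sphase: "continuous_on A sphase"
  by (meson DERIV_isCont continuous_at_imp_continuous_on sphase_deriv)

lemma continuous_on_vel: "continuous_on A vel"
  by (meson DERIV_isCont continuous_at_imp_continuous_on vel_deriv)

lemma continuous_on_phase: "continuous_on A phase"
  by (meson DERIV_isCont continuous_at_imp_continuous_on phase_deriv)

section \<open>Speed bound and inversion of the velocity map\<close>

lemma vel_sq: "(vel k)\<^sup>2 = p\<^sup>2 * (1 - (sin k)\<^sup>2) / (sphase k)\<^sup>2"
  by (simp add: vel_def power_divide power_mult_distrib cos_squared_eq)

text \<open>After multiplication by the square of \<open>sphase k\<close> the claim is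
  \<open>p * (1 - u^2) + p^2 * (u - s)^2 \<le> 1\<close>, which follows from
  \<open>\<bar>s\<bar> \<le> 1\<close> and \<open>p \<le> 1/2\<close>. The bound selects the right
  root of \<open>disc\<close> and keeps \<open>1 - (vel k)\<^sup>2\<close> positive.\<close>

lemma vel_sq_le: "(vel k)\<^sup>2 \<le> p"
proof -
  let ?u = "sin k"
  have u: "\<bar>?u\<bar> \<le> 1" by simp
  have "(?u - s)\<^sup>2 \<le> (1 + \<bar>?u\<bar>)\<^sup>2"
    using u s_le by (intro power2_le_iff_abs_le[THEN iffD2]) (linarith | simp)+
  moreover have "p\<^sup>2 \<le> p / 2" using p_pos p_le by (simp add: power2_eq_square)
  ultimately have 1: "p\<^sup>2 * (?u - s)\<^sup>2 \<le> p / 2 * (1 + \<bar>?u\<bar>)\<^sup>2"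
    using p_pos by (intro mult_mono) auto
  have "p * (1 - ?u\<^sup>2) + p / 2 * (1 + \<bar>?u\<bar>)\<^sup>2 = p / 2 * (3 + 2 * \<bar>?u\<bar> - \<bar>?u\<bar>\<^sup>2)"
    by (simp add: algebra_simps power2_eq_square)
  also have "\<dots> \<le> p / 2 * 4"
  proof (rule mult_left_mono)
    have "0 \<le> (1 - \<bar>?u\<bar>)\<^sup>2" by simp
    then show "3 + 2 * \<bar>?u\<bar> - \<bar>?u\<bar>\<^sup>2 \<le> 4" by (simp add: power2_diff)
  qed (use p_pos in auto)
  also have "\<dots> \<le> 1" using p_le by simp
  finally have "p * (1 - ?u\<^sup>2) \<le> (sphase k)\<^sup>2"
    using 1 by (simp add: sphase_sq power_mult_distrib)
  then have "p * (p * (1 - ?u\<^sup>2)) \<le> p * (sphase k)\<^sup>2"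
    using p_pos by (intro mult_left_mono) auto
  then show ?thesis
    unfolding vel_sq using sphase_pos[of k] by (simp add: divide_le_eq power2_eq_square mult.assoc)
qed

text \<open>The derivative of a quadratic polynomial at one of its roots squares to the
  discriminant. Here the polynomial is the one behind \<open>disc\<close>, the root is
  \<open>sin k\<close>, and the derivative there is
  \<open>2 * p\<^sup>2 * crit (sin k) / (sphase k)\<^sup>2\<close>.\<close>

lemma disc_vel: "disc (vel k) = (p * crit (sin k) / (sphase k)\<^sup>2)\<^sup>2"
proof -
  let ?u = "sin k" and ?E = "(sphase k)\<^sup>2"
  have E: "?E \<noteq> 0" using sphase_pos[of k] by simp
  have "disc (vel k) * ?E\<^sup>2 = p^4 * (1 - ?u\<^sup>2)\<^sup>2
      - (1 + p\<^sup>2 * (1 - s\<^sup>2)) * p\<^sup>2 * (1 - ?u\<^sup>2) * ?E + p\<^sup>2 * ?E\<^sup>2"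
    unfolding disc_def vel_sq using E by (simp add: field_simps eval_nat_numeral)
  also have "\<dots> = (p * crit ?u)\<^sup>2"
    unfolding sphase_sq crit_def by (simp add: algebra_simps eval_nat_numeral)
  finally show ?thesis using E by (simp add: power_divide field_simps)
qed

text \<open>The sign of \<open>crit\<close> selects which root \<open>u\<close> of the quadratic equation \<open>vel\<^sup>2 = x\<^sup>2\<close> in
  \<open>u = sin k\<close> occurs, and hence the sign in front of \<open>sqrt (disc x)\<close>.\<close>

lemma branch_vel:
  assumes "0 \<le> crit (sin k)"
  shows "branch (vel k) = ((1 - (vel k)\<^sup>2) * sphase k)\<^sup>2"
proof -
  let ?u = "sin k" and ?E = "(sphase k)\<^sup>2"
  have E: "?E \<noteq> 0" using sphase_pos[of k] by simp
  have sq: "sqrt (disc (vel k)) = p * crit ?u / ?E"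
    unfolding disc_vel using assms p_pos by simp
  have "branch (vel k) * ?E = (1 - p\<^sup>2 * (1 + s\<^sup>2)) * ?E
     - (1 - p\<^sup>2 * (1 - s\<^sup>2)) * p\<^sup>2 * (1 - ?u\<^sup>2) + 2 * p\<^sup>2 * s * crit ?u"
    unfolding branch_def sq vel_sq using E by (simp add: field_simps eval_nat_numeral)
  also have "\<dots> = (?E - p\<^sup>2 * (1 - ?u\<^sup>2))\<^sup>2"
    unfolding sphase_sq crit_def by (simp add: algebra_simps eval_nat_numeral)
  also have "\<dots> = ((1 - (vel k)\<^sup>2) * sphase k)\<^sup>2 * ?E"
    unfolding vel_sq using E by (simp add: field_simps eval_nat_numeral)
  finally show ?thesis using E by simp
qed

lemma crit_diff: "crit v - crit u = (v - u) * (p\<^sup>2 * s * (u + v) + 1 - p\<^sup>2 * (1 + s\<^sup>2))"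
  by (simp add: crit_def algebra_simps power2_eq_square)

text \<open>The second factor in \<open>crit_diff\<close> is at least
  \<open>1 - p\<^sup>2 * (1 + \<bar>s\<bar>)\<^sup>2\<close> on this interval, positive by
  \<open>gap_sq\<close>. Hence \<open>crit\<close> has at most one zero there and a fixed sign on
  either side of it.\<close>

lemma crit_less:
  assumes "-1 \<le> u" "u < v" "v \<le> 1"
  shows "crit u < crit v"
proof -
  have "\<bar>s * (u + v)\<bar> \<le> \<bar>s\<bar> * 2" unfolding abs_mult using assms by (intro mult_left_mono) auto
  then have "p\<^sup>2 * - (\<bar>s\<bar> * 2) \<le> p\<^sup>2 * (s * (u + v))"
    by (intro mult_left_mono) auto
  moreover have "p\<^sup>2 * (1 + \<bar>s\<bar>)\<^sup>2 = p\<^sup>2 * (1 + s\<^sup>2) - p\<^sup>2 * - (\<bar>s\<bar> * 2)"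
    by (simp add: algebra_simps power2_eq_square)
  ultimately have "0 < p\<^sup>2 * s * (u + v) + 1 - p\<^sup>2 * (1 + s\<^sup>2)"
    using gap_sq by (simp add: mult.assoc)
  then show ?thesis using crit_diff[of v u] assms by (smt (verit) mult_pos_pos)
qed

text \<open>The gap makes the value at -1 negative and the value at 1 positive. The points
  \<open>arcsin u\<close> and \<open>pi - arcsin u\<close> then bound the arc on which
  \<open>vel\<close> increases.\<close>

lemma crit_root: obtains u where "-1 < u" "u < 1" "crit u = 0"
proof -
  have "crit (-1) = p\<^sup>2 * (1 + s)\<^sup>2 - 1" "crit 1 = 1 - p\<^sup>2 * (1 - s)\<^sup>2"
    by (simp_all add: crit_def algebra_simps power2_eq_square)
  moreover have "p\<^sup>2 * (1 + s)\<^sup>2 \<le> p\<^sup>2 * (1 + \<bar>s\<bar>)\<^sup>2" "p\<^sup>2 * (1 - s)\<^sup>2 \<le> p\<^sup>2 * (1 + \<bar>s\<bar>)\<^sup>2"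
    using s_le by (auto intro!: mult_left_mono power_mono)
  ultimately have *: "crit (-1) < 0" "0 < crit 1" using gap_sq by linarith+
  have "continuous_on {-1..1} crit" unfolding crit_def[abs_def] by (intro continuous_intros)
  then obtain u where "-1 \<le> u" "u \<le> 1" "crit u = 0"
    using IVT'[of crit "-1" 0 1] * by auto
  then show ?thesis using that[of u] * by (metis less_eq_real_def less_irrefl)
qed

section \<open>The maximal speed as a root of the discriminant\<close>

definition midd :: real where "midd = 1 + p\<^sup>2 * (1 - s\<^sup>2)"

lemma disc_eq: "4 * disc x = (2 * x\<^sup>2 - midd)\<^sup>2 - (midd\<^sup>2 - 4 * p\<^sup>2)"
  by (simp add: disc_def midd_def algebra_simps power2_eq_square)

text \<open>The two radicands in \<open>vmax\<close> have sum \<open>2 * midd\<close> and product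
  \<open>midd\<^sup>2 - 4 * p\<^sup>2\<close>, so squaring the difference of their roots gives a
  root of \<open>disc\<close> in the variable \<open>x\<^sup>2\<close>.\<close>

lemma vmax_aux:
  shows "0 < vmax" "vmax\<^sup>2 = (midd - sqrt (midd\<^sup>2 - 4 * p\<^sup>2)) / 2" "2 * p \<le> midd"
    "4 * p\<^sup>2 \<le> midd\<^sup>2"
proof -
  let ?a = "(1 + p)\<^sup>2 - p\<^sup>2 * s\<^sup>2" and ?b = "(1 - p)\<^sup>2 - p\<^sup>2 * s\<^sup>2"
  have "(p * \<bar>s\<bar>)\<^sup>2 \<le> (1 - p)\<^sup>2"
    using gap p_pos by (intro power_mono) (auto simp: algebra_simps)
  then have b: "0 \<le> ?b" by (simp add: power_mult_distrib)
  have ab: "?b < ?a" using p_pos by (simp add: power2_eq_square algebra_simps)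
  then show "0 < vmax" by (simp add: vmax_def)
  have "?a * ?b = midd\<^sup>2 - 4 * p\<^sup>2"
    by (simp add: midd_def algebra_simps power2_eq_square)
  then have prod: "sqrt ?a * sqrt ?b = sqrt (midd\<^sup>2 - 4 * p\<^sup>2)"
    by (simp flip: real_sqrt_mult)
  have "4 * vmax\<^sup>2 = (sqrt ?a)\<^sup>2 + (sqrt ?b)\<^sup>2 - 2 * (sqrt ?a * sqrt ?b)"
    unfolding vmax_def by (simp add: algebra_simps power2_eq_square)
  also have "(sqrt ?a)\<^sup>2 + (sqrt ?b)\<^sup>2 = ?a + ?b" using b ab by simp
  also have "\<dots> = 2 * midd" by (simp add: midd_def algebra_simps power2_eq_square)
  finally show "vmax\<^sup>2 = (midd - sqrt (midd\<^sup>2 - 4 * p\<^sup>2)) / 2" unfolding prod by simp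
  have "s\<^sup>2 \<le> 1" using s_le by (simp add: abs_square_le_1)
  then have "0 \<le> p\<^sup>2 * (1 - s\<^sup>2)" by simp
  then show le: "2 * p \<le> midd" unfolding midd_def using p_le by linarith
  have "(2 * p)\<^sup>2 \<le> midd\<^sup>2" using le p_pos by (intro power_mono) auto
  then show "4 * p\<^sup>2 \<le> midd\<^sup>2" by (simp add: power_mult_distrib)
qed

text \<open>The roots of \<open>disc\<close> in \<open>x\<^sup>2\<close> have product \<open>p\<^sup>2\<close>, so the bound \<open>p\<close> on \<open>vel\<^sup>2\<close> singles out the
  smaller one, \<open>vmax\<^sup>2\<close>.\<close>

lemma vmax_sq_le: "vmax\<^sup>2 \<le> p"
proof -
  have "(midd - 2 * p)\<^sup>2 \<le> midd\<^sup>2 - 4 * p\<^sup>2"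
    using vmax_aux(3) p_pos by (simp add: power2_eq_square algebra_simps)
  then have "midd - 2 * p \<le> sqrt (midd\<^sup>2 - 4 * p\<^sup>2)" by (rule real_le_rsqrt)
  then show ?thesis using vmax_aux(2) by simp
qed

text \<open>By \<open>disc_eq\<close> the sign of \<open>disc x\<close> is that of a difference of
  two squares. Both bases are nonnegative, \<open>midd - 2 * x\<^sup>2\<close> because
  \<open>x\<^sup>2 \<le> p\<close>, so the bases themselves can be compared.\<close>

lemma disc_pos_iff:
  assumes "x\<^sup>2 \<le> p"
  shows "0 < disc x \<longleftrightarrow> \<bar>x\<bar> < vmax" and "disc x = 0 \<longleftrightarrow> \<bar>x\<bar> = vmax"
proof -
  let ?R = "sqrt (midd\<^sup>2 - 4 * p\<^sup>2)" and ?y = "midd - 2 * x\<^sup>2"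
  have y: "0 \<le> ?y" using assms vmax_aux(3) by simp
  have R: "?R\<^sup>2 = midd\<^sup>2 - 4 * p\<^sup>2" "0 \<le> ?R" using vmax_aux(4) by simp_all
  have eq: "4 * disc x = ?y\<^sup>2 - ?R\<^sup>2" unfolding disc_eq R by (simp add: power2_commute)
  have le1: "vmax \<le> \<bar>x\<bar> \<longleftrightarrow> vmax\<^sup>2 \<le> x\<^sup>2" and le2: "\<bar>x\<bar> \<le> vmax \<longleftrightarrow> x\<^sup>2 \<le> vmax\<^sup>2"
    using abs_le_square_iff[of vmax x] abs_le_square_iff[of x vmax] vmax_aux(1) by simp_all
  have abs: "\<bar>x\<bar> < vmax \<longleftrightarrow> x\<^sup>2 < vmax\<^sup>2" "\<bar>x\<bar> = vmax \<longleftrightarrow> x\<^sup>2 = vmax\<^sup>2"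
    using le1 le2 by linarith+
  have "0 < disc x \<longleftrightarrow> ?R\<^sup>2 < ?y\<^sup>2" "disc x = 0 \<longleftrightarrow> ?y\<^sup>2 = ?R\<^sup>2" using eq by linarith+
  moreover have "?R\<^sup>2 < ?y\<^sup>2 \<longleftrightarrow> ?R < ?y"
    using abs_le_square_iff[of ?y ?R] y R(2) by linarith
  moreover have "?y\<^sup>2 = ?R\<^sup>2 \<longleftrightarrow> ?y = ?R"
    using y R(2) by (rule power2_eq_iff_nonneg)
  ultimately show "0 < disc x \<longleftrightarrow> \<bar>x\<bar> < vmax" and "disc x = 0 \<longleftrightarrow> \<bar>x\<bar> = vmax"
    unfolding abs vmax_aux(2) by (auto simp: field_simps)
qed

lemma abs_less_vmax:
  assumes "\<bar>x\<bar> < vmax"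
  shows "0 < disc x" "x\<^sup>2 < p"
proof -
  have "x\<^sup>2 < vmax\<^sup>2" using assms by (simp add: power2_strict_mono)
  then show "x\<^sup>2 < p" using vmax_sq_le by simp
  then show "0 < disc x" using disc_pos_iff(1)[of x] assms by simp
qed

text \<open>At a zero of \<open>crit\<close> the discriminant vanishes, so the speed is
  \<open>vmax\<close>; the sign is read off from the cosine. This identifies the explicit radical
  with the speed at the turning points.\<close>

lemma vel_at_critical:
  assumes "-1 < u" "u < 1" "crit u = 0"
  shows "vel (arcsin u) = - vmax" "vel (pi - arcsin u) = vmax"
proof -
  have sin: "sin (arcsin u) = u" using assms by simp
  have "disc (vel (arcsin u)) = 0" unfolding disc_vel sin assms(3) by simp
  then have "\<bar>vel (arcsin u)\<bar> = vmax" using disc_pos_iff(2)[OF vel_sq_le] by simp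
  moreover have "vel (arcsin u) < 0"
    using assms p_pos sphase_pos by (simp add: vel_def cos_arcsin abs_square_less_1)
  ultimately show "vel (arcsin u) = - vmax" by simp
  then show "vel (pi - arcsin u) = vmax" by (simp add: vel_def sphase_def)
qed

section \<open>Image of Lebesgue measure on the increasing arc\<close>

lemma sin_gt:
  assumes "-1 < u" "u < 1" "arcsin u < k" "k < pi - arcsin u"
  shows "u < sin k"
proof (cases "k \<le> pi/2")
  case True
  have "sin (arcsin u) < sin k"
    using True assms arcsin_lbound[of u] by (intro sin_monotone_2pi) auto
  then show ?thesis using assms by simp
next
  case False
  have "sin (arcsin u) < sin (pi - k)"
    using False assms arcsin_lbound[of u] by (intro sin_monotone_2pi) auto
  then show ?thesis using assms by simp
qed

text \<open>\<open>push_density\<close> is the reciprocal of the derivative of \<open>vel\<close>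
  along the open increasing arc. The ends are excluded because the derivative vanishes
  there.\<close>

lemma push_density_vel:
  assumes "-1 < u" "u < 1" "crit u = 0" "arcsin u < k" "k < pi - arcsin u"
  shows "push_density (vel k) * (p * crit (sin k) / (sphase k) ^ 3) = 1"
proof -
  have c: "0 < crit (sin k)"
    using crit_less[of u "sin k"] sin_gt[OF assms(1,2,4,5)] assms by simp
  have S: "0 < sphase k" by (rule sphase_pos)
  have x: "1 - (vel k)\<^sup>2 > 0" using vel_sq_le[of k] p_le by linarith
  have sq: "sqrt (disc (vel k)) = p * crit (sin k) / (sphase k)\<^sup>2"
    unfolding disc_vel using c p_pos by simp
  have sb: "sqrt (branch (vel k)) = (1 - (vel k)\<^sup>2) * sphase k"
    using branch_vel[of k] c x S by (simp add: abs_of_pos)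
  have "0 < disc (vel k)" unfolding disc_vel using c p_pos S by simp
  then have "\<bar>vel k\<bar> < vmax" using disc_pos_iff(1)[OF vel_sq_le] by simp
  then have "vel k \<in> {- vmax<..<vmax}" by auto
  then have "push_density (vel k) = (1 - (vel k)\<^sup>2) * sphase k / ((1 - (vel k)\<^sup>2) * (p * crit (sin k) / (sphase k)\<^sup>2))"
    unfolding push_density_def sb sq by simp
  also have "\<dots> = sphase k ^ 3 / (p * crit (sin k))"
    using x S c p_pos by (simp add: field_simps eval_nat_numeral)
  finally show ?thesis using S c p_pos by simp
qed

lemma push_density_measurable [measurable]: "push_density \<in> borel_measurable borel"
  unfolding push_density_def branch_def disc_def by measurable

text \<open>\<open>branch x\<close> is the difference of squares
  \<open>(1 - x^2)^2 - (sqrt (disc x) - p * s)^2\<close>. It suffices that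
  \<open>sqrt (disc x)\<close> is at most \<open>1 - x^2 - p * \<bar>s\<bar>\<close>, and the
  difference of the squares of these two factors into nonnegative terms.\<close>

lemma branch_nonneg:
  assumes "\<bar>x\<bar> < vmax"
  shows "0 \<le> branch x"
proof -
  have x: "0 < disc x" "x\<^sup>2 < p" using abs_less_vmax[OF assms] by auto
  let ?r = "sqrt (disc x)" and ?q = "p * \<bar>s\<bar>"
  have g: "p < 1 - ?q" using gap by (simp add: algebra_simps)
  have "(1 - x\<^sup>2 - ?q)\<^sup>2 - disc x = (1 - x\<^sup>2) * ((1 - ?q)\<^sup>2 - p\<^sup>2)"
    unfolding disc_def by (simp add: algebra_simps power2_eq_square)
  moreover have "p\<^sup>2 \<le> (1 - ?q)\<^sup>2" using g p_pos by (intro power_mono) auto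
  moreover have "x\<^sup>2 \<le> 1" using x(2) p_le by linarith
  ultimately have "disc x \<le> (1 - x\<^sup>2 - ?q)\<^sup>2" by (smt (verit) mult_nonneg_nonneg)
  then have "?r \<le> 1 - x\<^sup>2 - ?q" using x g by (intro real_le_lsqrt) auto
  moreover have "\<bar>?r - p * s\<bar> \<le> ?r + ?q"
    using x(1) p_pos abs_triangle_ineq4[of ?r "p * s"] by (simp add: abs_mult)
  ultimately have "(?r - p * s)\<^sup>2 \<le> (1 - x\<^sup>2)\<^sup>2" by (intro power2_le_iff_abs_le[THEN iffD2]) auto
  moreover have "branch x = (1 - x\<^sup>2)\<^sup>2 - (?r\<^sup>2 - 2 * p * s * ?r + (p * s)\<^sup>2)"
    using x(1) unfolding branch_def by (simp add: disc_def algebra_simps power2_eq_square)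
  ultimately show ?thesis by (simp add: power2_diff algebra_simps)
qed

lemma push_density_nonneg: "0 \<le> push_density x"
proof (cases "\<bar>x\<bar> < vmax")
  case True
  have "x\<^sup>2 \<le> 1" "0 < disc x" using abs_less_vmax[OF True] p_le by simp_all
  then show ?thesis using branch_nonneg[OF True] by (simp add: push_density_def)
qed (auto simp: push_density_def abs_less_iff split: split_indicator)

text \<open>\<open>vel\<close> rises from \<open>- vmax\<close> to \<open>vmax\<close> on this arc,
  so this is the substitution rule tested on an arbitrary Borel set, with the Jacobian cancelled by
  \<open>push_density_vel\<close>.\<close>

lemma distr_vel:
  assumes "-1 < u" "u < 1" "crit u = 0"
  shows "distr (density lborel (indicator {arcsin u..pi - arcsin u})) borel vel = density lborel push_density"
proof (rule measure_eqI)
  let ?a = "arcsin u" and ?b = "pi - arcsin u"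
  let ?g' = "\<lambda>k. p * crit (sin k) / (sphase k) ^ 3"
  have vm[measurable]: "vel \<in> borel_measurable borel"
    by (intro borel_measurable_continuous_onI continuous_on_vel)
  have ab: "?a \<le> ?b" using arcsin_ubound[of u] assms by simp
  fix A assume "A \<in> sets (distr (density lborel (indicator {?a..?b})) borel vel)"
  then have A[measurable]: "A \<in> sets borel" by simp
  have ends: "sin ?a = u" "sin ?b = u" using assms by simp_all
  have crit_ge: "0 \<le> crit (sin k)" if k: "k \<in> {?a..?b}" for k
  proof (cases "k = ?a \<or> k = ?b")
    case True
    then show ?thesis using ends assms(3) by auto
  next
    case False
    then have "u < sin k" using k by (intro sin_gt[OF assms(1,2)]) auto
    then show ?thesis using crit_less[of u "sin k"] assms by simp
  qed
  have "emeasure (density lborel push_density) A = (\<integral>\<^sup>+x. push_density x * indicator A x \<partial>lborel)"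
    by (subst emeasure_density) (auto intro!: nn_integral_cong split: split_indicator)
  also have "\<dots> = (\<integral>\<^sup>+x. ennreal (push_density x * indicator A x) * indicator {vel ?a..vel ?b} x \<partial>lborel)"
    unfolding vel_at_critical[OF assms]
    by (intro nn_integral_cong) (auto split: split_indicator simp: push_density_def)
  also have "\<dots> = (\<integral>\<^sup>+x. ennreal (push_density x * indicator A x * indicator {vel ?a..vel ?b} x) \<partial>lborel)"
    by (intro nn_integral_cong) (auto split: split_indicator)
  also have "\<dots> = (\<integral>\<^sup>+k. ennreal (push_density (vel k) * indicator A (vel k) * ?g' k * indicator {?a..?b} k) \<partial>lborel)"
  proof (rule nn_integral_substitution[OF _ vel_deriv _ _ ab])
    show "set_borel_measurable borel {vel ?a..vel ?b} (\<lambda>x. push_density x * indicator A x)"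
      unfolding set_borel_measurable_def by measurable
    show "continuous_on {?a..?b} ?g'"
      unfolding crit_def using sphase_pos
      by (intro continuous_intros continuous_on_sphase) (auto simp: less_imp_neq[symmetric])
    show "0 \<le> ?g' k" if "k \<in> {?a..?b}" for k
      using crit_ge[OF that] p_pos sphase_pos[of k] by simp
  qed
  also have "\<dots> = (\<integral>\<^sup>+k. indicator {?a..?b} k * indicator A (vel k) \<partial>lborel)"
  proof (rule nn_integral_cong_AE)
    \<comment> \<open>At the two ends the Jacobian is zero and the cancellation fails, but they form
      a null set.\<close>
    have "AE k in lborel. k \<noteq> ?a" "AE k in lborel. k \<noteq> ?b" by (rule AE_lborel_singleton)+
    then show "AE k in lborel. ennreal (push_density (vel k) * indicator A (vel k) * ?g' k * indicator {?a..?b} k)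
        = indicator {?a..?b} k * indicator A (vel k)"
    proof eventually_elim
      case (elim k)
      show ?case
      proof (cases "k \<in> {?a..?b}")
        case True
        with elim have "?a < k" "k < ?b" by auto
        from push_density_vel[OF assms this] True show ?thesis
          by (auto split: split_indicator)
      qed auto
    qed
  qed
  also have "\<dots> = (\<integral>\<^sup>+k. indicator {?a..?b} k * indicator (vel -` A) k \<partial>lborel)"
    by (simp add: indicator_def)
  also have "\<dots> = emeasure (density lborel (indicator {?a..?b})) (vel -` A)"
    by (subst emeasure_density) (auto intro: measurable_sets_borel[OF vm, of A])
  also have "\<dots> = emeasure (distr (density lborel (indicator {?a..?b})) borel vel) A"
    by (subst emeasure_distr) auto
  finally show "emeasure (distr (density lborel (indicator {?a..?b})) borel vel) A
      = emeasure (density lborel push_density) A" ..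
qed simp

lemma integral_push_density:
  fixes G :: "real \<Rightarrow> complex"
  assumes "-1 < u" "u < 1" "crit u = 0" and G: "continuous_on UNIV G"
  shows "integrable lborel (\<lambda>y. push_density y *\<^sub>R G y)"
    and "(\<integral>y. push_density y *\<^sub>R G y \<partial>lborel) = integral {arcsin u..pi - arcsin u} (\<lambda>k. G (vel k))"
proof -
  let ?I = "{arcsin u..pi - arcsin u}"
  have Gm[measurable]: "G \<in> borel_measurable borel" by (rule borel_measurable_continuous_onI[OF G])
  have vm[measurable]: "vel \<in> borel_measurable borel"
    by (intro borel_measurable_continuous_onI continuous_on_vel)
  have "continuous_on ?I (\<lambda>k. G (vel k))"
    by (intro continuous_on_compose2[OF G continuous_on_vel]) auto
  then have int: "set_integrable lborel ?I (\<lambda>k. G (vel k))"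
    unfolding set_integrable_def by (intro borel_integrable_compact) auto
  have ind: "(indicator ?I :: real \<Rightarrow> ennreal) = (\<lambda>k. ennreal (indicat_real ?I k))"
    by (simp add: fun_eq_iff ennreal_indicator)
  have "integrable (distr (density lborel (indicator ?I)) borel vel) G"
    unfolding ind using int by (subst integrable_distr_eq) (simp_all add: integrable_density set_integrable_def)
  then show "integrable lborel (\<lambda>y. push_density y *\<^sub>R G y)"
    unfolding distr_vel[OF assms(1-3)] by (simp add: integrable_density push_density_nonneg)
  have "(\<integral>y. push_density y *\<^sub>R G y \<partial>lborel) = (\<integral>y. G y \<partial>density lborel push_density)"
    by (simp add: integral_density push_density_nonneg)
  also have "\<dots> = (\<integral>k. G (vel k) \<partial>density lborel (indicator ?I))"
    unfolding distr_vel[OF assms(1-3), symmetric] by (subst integral_distr) auto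
  also have "\<dots> = (LINT k:?I|lborel. G (vel k))"
    unfolding ind set_lebesgue_integral_def by (subst integral_density) auto
  also have "\<dots> = integral ?I (\<lambda>k. G (vel k))"
    using int by (rule set_borel_integral_eq_integral)
  finally show "(\<integral>y. push_density y *\<^sub>R G y \<partial>lborel) = integral ?I (\<lambda>k. G (vel k))" .
qed

end

subsection \<open>Periodic integrals and Fourier sums\<close>

lemma integral_periodic:
  fixes f :: "real \<Rightarrow> 'a::banach"
  assumes cont: "continuous_on UNIV f" and per: "\<And>x. f (x + T) = f x"
    and ab: "a \<le> b" "b \<le> a + T"
  shows "integral {a..a + T} f = integral {b..b + T} f"
proof -
  have int: "f integrable_on {x..y}" for x y
    using cont by (intro integrable_continuous_real) (auto intro: continuous_on_subset)
  have "integral {a + T..b + T} f = integral {a..b} (f \<circ> (+) T)"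
    by (simp add: integral_shift_Icc_real)
  also have "\<dots> = integral {a..b} f"
    by (simp add: o_def per add.commute[of T])
  finally have "integral {a + T..b + T} f = integral {a..b} f" .
  then show ?thesis
    using Henstock_Kurzweil_Integration.integral_combine[OF ab int]
      Henstock_Kurzweil_Integration.integral_combine[of b "a + T" "b + T" f] ab int
    by (simp add: add.commute)
qed

lemma integral_reflect_about:
  fixes f :: "real \<Rightarrow> 'a::banach"
  shows "integral {c - b..c - a} (\<lambda>x. f (c - x)) = integral {a..b} f"
proof -
  have "integral {a..b} f = integral {-b..-a} (\<lambda>x. f (- x))" by simp
  also have "\<dots> = integral {-b + c..-a + c} (\<lambda>x. f (- (x - c)))"
    using integral_shift_Icc_real[of "-b" "-a" "\<lambda>x. f (- (x - c))" c] by (simp add: o_def)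
  finally show ?thesis by (simp add: algebra_simps)
qed

lemma has_integral_cis:
  fixes m :: int
  shows "((\<lambda>k. cis (k * of_int m)) has_integral (if m = 0 then of_real (2 * pi) else 0)) {c..c + 2 * pi}"
proof (cases "m = 0")
  case True
  then show ?thesis using has_integral_const_real[of "1::complex" c "c + 2 * pi"]
    by (simp add: scaleR_conv_of_real)
next
  case False
  have "((\<lambda>k. cis (k * of_int m)) has_integral
      (cis ((c + 2 * pi) * of_int m) / (\<i> * of_int m) - cis (c * of_int m) / (\<i> * of_int m))) {c..c + 2 * pi}"
  proof (rule fundamental_theorem_of_calculus)
    fix k :: real
    have "((\<lambda>z. exp (\<i> * of_int m * z) / (\<i> * of_int m)) has_field_derivative
        exp (\<i> * of_int m * of_real k)) (at (of_real k))"
      using False by (auto intro!: derivative_eq_intros)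
    from has_vector_derivative_real_field[OF this]
    show "((\<lambda>k. cis (k * of_int m) / (\<i> * of_int m)) has_vector_derivative cis (k * of_int m)) (at k within {c..c + 2 * pi})"
      by (simp add: cis_conv_exp mult_ac)
  qed simp
  moreover have "cis ((c + 2 * pi) * of_int m) = cis (c * of_int m)"
  proof -
    have "cis (2 * pi * of_int m) = 1" by (simp add: cis_multiple_2pi)
    then show ?thesis by (simp add: ring_distribs cis_mult[symmetric])
  qed
  ultimately show ?thesis using False by simp
qed

text \<open>A finite window suffices, since at time \<open>t\<close> the walk is supported in
  \<open>{- int t..int t}\<close>.\<close>

definition fourier :: "nat \<Rightarrow> (int \<Rightarrow> complex) \<Rightarrow> real \<Rightarrow> complex" where
  "fourier n a k = (\<Sum>x\<in>{- int n..int n}. a x * cis (- (k * of_int x)))"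

text \<open>The window grows by one because a shift by at most one site moves the support by at most
  one; reindexing then turns the shift into a phase.\<close>

lemma fourier_shift:
  assumes supp: "\<And>x. int n < \<bar>x\<bar> \<Longrightarrow> a x = 0" and d: "\<bar>d\<bar> \<le> 1"
  shows "fourier (Suc n) (\<lambda>x. a (x + d)) k = cis (k * of_int d) * fourier n a k"
proof -
  let ?g = "\<lambda>x. a x * cis (- (k * of_int x))"
  have "fourier (Suc n) (\<lambda>x. a (x + d)) k
      = (\<Sum>x\<in>{- int (Suc n)..int (Suc n)}. cis (k * of_int d) * ?g (x + d))"
    unfolding fourier_def by (intro sum.cong) (auto simp: cis_mult algebra_simps)
  also have "\<dots> = cis (k * of_int d) * (\<Sum>x\<in>{- int (Suc n)..int (Suc n)}. ?g (x + d))"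
    by (simp add: sum_distrib_left)
  also have "(\<Sum>x\<in>{- int (Suc n)..int (Suc n)}. ?g (x + d))
      = (\<Sum>x\<in>{- int (Suc n) + d..int (Suc n) + d}. ?g x)"
    by (rule sum.reindex_bij_witness[of _ "\<lambda>x. x - d" "\<lambda>x. x + d"]) auto
  also have "\<dots> = (\<Sum>x\<in>{- int n..int n}. ?g x)"
    using d by (intro sum.mono_neutral_right) (auto intro!: supp)
  finally show ?thesis by (simp add: fourier_def)
qed

lemma fourier_add: "fourier n (\<lambda>x. a x + b x) k = fourier n a k + fourier n b k"
  by (simp add: fourier_def sum.distrib ring_distribs)

lemma fourier_cmult: "fourier n (\<lambda>x. c * a x) k = c * fourier n a k"
  by (simp add: fourier_def sum_distrib_left mult.assoc)

text \<open>Orthogonality of the characters leaves only the diagonal terms of the expanded product.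
  Translating one factor by \<open>d\<close> thus produces the characteristic function of the
  weights at \<open>d\<close>; \<open>e\<close> allows a change of origin in momentum and
  cancels.\<close>

lemma parseval_shift:
  "((\<lambda>k. cnj (fourier n a (k + e)) * fourier n a (k + e - d)) has_integral
     of_real (2 * pi) * (\<Sum>x\<in>{- int n..int n}. of_real ((cmod (a x))\<^sup>2) * cis (d * of_int x))) {c..c + 2 * pi}"
proof -
  let ?A = "{- int n..int n}"
  let ?c = "\<lambda>x y. cnj (a x) * a y * cis (e * of_int (x - y) + d * of_int y)"
  have expand: "cnj (fourier n a (k + e)) * fourier n a (k + e - d)
      = (\<Sum>x\<in>?A. \<Sum>y\<in>?A. ?c x y * cis (k * of_int (x - y)))" for k
    unfolding fourier_def cnj_sum sum_product
    by (intro sum.cong refl) (simp add: cis_cnj cis_mult algebra_simps)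
  have "((\<lambda>k. \<Sum>x\<in>?A. \<Sum>y\<in>?A. ?c x y * cis (k * of_int (x - y))) has_integral
     (\<Sum>x\<in>?A. \<Sum>y\<in>?A. ?c x y * (if x - y = 0 then of_real (2 * pi) else 0))) {c..c + 2 * pi}"
    by (intro has_integral_sum has_integral_mult_right has_integral_cis) auto
  also have "(\<Sum>x\<in>?A. \<Sum>y\<in>?A. ?c x y * (if x - y = 0 then of_real (2 * pi) else 0))
     = (\<Sum>x\<in>?A. of_real (2 * pi) * (of_real ((cmod (a x))\<^sup>2) * cis (d * of_int x)))"
  proof (intro sum.cong refl)
    fix x assume x: "x \<in> ?A"
    have "(\<Sum>y\<in>?A. ?c x y * (if x - y = 0 then of_real (2 * pi) else 0))
        = (\<Sum>y\<in>?A. if x = y then ?c x x * of_real (2 * pi) else 0)"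
      by (intro sum.cong) auto
    also have "\<dots> = ?c x x * of_real (2 * pi)" using x by simp
    also have "\<dots> = of_real (2 * pi) * (of_real ((cmod (a x))\<^sup>2) * cis (d * of_int x))"
      using complex_norm_square[of "a x"] by (simp add: mult_ac)
    finally show "(\<Sum>y\<in>?A. ?c x y * (if x - y = 0 then of_real (2 * pi) else 0))
        = of_real (2 * pi) * (of_real ((cmod (a x))\<^sup>2) * cis (d * of_int x))" .
  qed
  finally show ?thesis unfolding expand by (simp add: sum_distrib_left)
qed

section \<open>Linear algebra of unitary 2x2 matrices\<close>

lemma cnj_mult_self: "cnj z * z = complex_of_real ((cmod z)\<^sup>2)"
  using complex_norm_square[of z] by (simp only: mult.commute)

lemma unitary_2x2_cinner:
  fixes a b c d :: complex
  assumes "(cmod a)\<^sup>2 + (cmod c)\<^sup>2 = 1" "(cmod b)\<^sup>2 + (cmod d)\<^sup>2 = 1" "cnj a * b + cnj c * d = 0"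
  shows "cnj (a * x + b * y) * (a * z + b * w) + cnj (c * x + d * y) * (c * z + d * w)
    = cnj x * z + cnj y * w"
proof -
  have 1: "cnj a * a + cnj c * c = 1" "cnj b * b + cnj d * d = 1"
    unfolding cnj_mult_self of_real_add[symmetric] assms(1,2) by simp_all
  have 2: "cnj b * a + cnj d * c = 0"
    using arg_cong[OF assms(3), of cnj] by (simp add: mult.commute)
  have "cnj (a * x + b * y) * (a * z + b * w) + cnj (c * x + d * y) * (c * z + d * w)
    = (cnj a * a + cnj c * c) * (cnj x * z) + (cnj b * b + cnj d * d) * (cnj y * w)
      + (cnj a * b + cnj c * d) * (cnj x * w) + (cnj b * a + cnj d * c) * (cnj y * z)"
    by (simp add: algebra_simps)
  then show ?thesis using 1 2 assms(3) by simp
qed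

text \<open>Cayley-Hamilton: a 2x2 matrix M with eigenvalues l and m satisfies (M - l)(M - m) = 0,
  so (m - M)v is, for any vector v, zero or an eigenvector for l.\<close>

lemma eigen_aux:
  fixes u v w x l m \<alpha> \<beta> :: complex
  assumes "l + m = u + x" "l * m = -1" "u * x - v * w = -1"
  shows "u * (m * \<alpha> - (u * \<alpha> + v * \<beta>)) + v * (m * \<beta> - (w * \<alpha> + x * \<beta>)) = l * (m * \<alpha> - (u * \<alpha> + v * \<beta>))"
    and "w * (m * \<alpha> - (u * \<alpha> + v * \<beta>)) + x * (m * \<beta> - (w * \<alpha> + x * \<beta>)) = l * (m * \<beta> - (w * \<alpha> + x * \<beta>))"
  using assms by algebra+

lemma cinner_bound:
  fixes x y z w :: complex
  assumes "(cmod x)\<^sup>2 + (cmod y)\<^sup>2 = 1" "(cmod z)\<^sup>2 + (cmod w)\<^sup>2 = 1"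
  shows "cmod (cnj x * z + cnj y * w) \<le> 1"
proof -
  have "cmod (cnj x * z + cnj y * w) \<le> cmod x * cmod z + cmod y * cmod w"
    using norm_triangle_ineq[of "cnj x * z" "cnj y * w"] by (simp add: norm_mult)
  also have "\<dots> \<le> 1"
    using assms zero_le_power2[of "cmod x - cmod z"] zero_le_power2[of "cmod y - cmod w"]
    by (simp add: power2_diff)
  finally show ?thesis .
qed

lemma continuous_on_compose_UNIV:
  "continuous_on UNIV g \<Longrightarrow> continuous_on A f \<Longrightarrow> continuous_on A (\<lambda>x. g (f x))"
  by (rule continuous_on_compose2) auto

subsection \<open>Spectral decomposition of the walk\<close>

locale walk =
  fixes \<rho> \<nu> :: real and \<alpha> \<beta> :: complex
  assumes rho: "0 < \<rho>" "\<rho> < 1"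
    and spectral_gap: "\<rho> * rho0 \<rho> * (1 + \<bar>sin \<nu>\<bar>) < 1"
    and unit: "(cmod \<alpha>)\<^sup>2 + (cmod \<beta>)\<^sup>2 = 1"
begin

lemma rho0: "0 < rho0 \<rho>" "(rho0 \<rho>)\<^sup>2 = 1 - \<rho>\<^sup>2"
proof -
  have "\<rho>\<^sup>2 < 1" using rho by (simp add: abs_square_less_1)
  then show "0 < rho0 \<rho>" "(rho0 \<rho>)\<^sup>2 = 1 - \<rho>\<^sup>2" by (simp_all add: rho0_def)
qed

sublocale band "\<rho> * rho0 \<rho>" "sin \<nu>"
proof
  have "0 \<le> (\<rho> - rho0 \<rho>)\<^sup>2" by simp
  then show "\<rho> * rho0 \<rho> \<le> 1/2" using rho0 by (simp add: power2_diff)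
qed (use rho rho0 spectral_gap in auto)

text \<open>Entries of the Fourier symbol of \<open>Uop\<close> at momentum
  \<open>k + \<nu>\<close>; the factors \<open>cis\<close> record the hops to neighbouring
  sites.\<close>

definition u11 where "u11 k = - alpha0 \<rho> \<nu> * rho0 \<rho> * (1 + cis (- (k + \<nu>)))"
definition u12 where "u12 k = - (1 - (rho0 \<rho>)\<^sup>2) + (rho0 \<rho>)\<^sup>2 * cis (- (k + \<nu>))"
definition u21 where "u21 k = - (1 - (rho0 \<rho>)\<^sup>2) + (rho0 \<rho>)\<^sup>2 * cis (k + \<nu>)"
definition u22 where "u22 k = rho0 \<rho> * cnj (alpha0 \<rho> \<nu>) * (1 + cis (k + \<nu>))"

text \<open>The momentum is shifted by \<open>\<nu>\<close>, so that the dispersion relation depends on it only through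
  \<open>sin k\<close>.\<close>

definition amp0 where "amp0 t k = fourier t (\<lambda>x. fst (psi \<rho> \<nu> \<alpha> \<beta> t x)) (k + \<nu>)"
definition amp1 where "amp1 t k = fourier t (\<lambda>x. snd (psi \<rho> \<nu> \<alpha> \<beta> t x)) (k + \<nu>)"

lemma psi_support: "int t < \<bar>x\<bar> \<Longrightarrow> psi \<rho> \<nu> \<alpha> \<beta> t x = (0, 0)"
proof (induction t arbitrary: x)
  case 0
  then show ?case by (simp add: psi0_def)
next
  case (Suc t)
  then have "psi \<rho> \<nu> \<alpha> \<beta> t (x + 1) = (0, 0)" "psi \<rho> \<nu> \<alpha> \<beta> t x = (0, 0)" "psi \<rho> \<nu> \<alpha> \<beta> t (x - 1) = (0, 0)"
    by auto
  then show ?case by (simp add: Uop_def coinA_def coinB_def coinC_def)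
qed

lemma f_0: "amp0 0 k = \<alpha>" "amp1 0 k = \<beta>"
  by (simp_all add: amp0_def amp1_def fourier_def psi0_def)

lemma f_Suc:
  "amp0 (Suc t) k = u11 k * amp0 t k + u12 k * amp1 t k"
  "amp1 (Suc t) k = u21 k * amp0 t k + u22 k * amp1 t k"
proof -
  let ?a = "\<lambda>x. fst (psi \<rho> \<nu> \<alpha> \<beta> t x)" and ?b = "\<lambda>x. snd (psi \<rho> \<nu> \<alpha> \<beta> t x)"
  let ?r = "complex_of_real (rho0 \<rho>)" and ?c = "alpha0 \<rho> \<nu>" and ?K = "k + \<nu>"
  have supp: "\<forall>x. int t < \<bar>x\<bar> \<longrightarrow> ?a x = 0" "\<forall>x. int t < \<bar>x\<bar> \<longrightarrow> ?b x = 0"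
    using psi_support[of t] by auto
  have sh: "fourier (Suc t) (\<lambda>x. a (x + 1)) ?K = cis ?K * fourier t a ?K"
    "fourier (Suc t) (\<lambda>x. a (x - 1)) ?K = cis (- ?K) * fourier t a ?K"
    "fourier (Suc t) a ?K = fourier t a ?K" if "\<forall>x. int t < \<bar>x\<bar> \<longrightarrow> a x = 0" for a
    using fourier_shift[of t a 1 ?K] fourier_shift[of t a "-1" ?K] fourier_shift[of t a 0 ?K] that
    by auto
  note sa = sh[OF supp(1)] and sb = sh[OF supp(2)]
  have e1: "(\<lambda>x. fst (psi \<rho> \<nu> \<alpha> \<beta> (Suc t) x))
      = (\<lambda>x. (- ?c * ?r) * ?a x + (- (1 - ?r\<^sup>2)) * ?b x
           + ((- ?c * ?r) * ?a (x - 1) + ?r\<^sup>2 * ?b (x - 1)))"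
    by (auto simp: Uop_def coinA_def coinB_def coinC_def Let_def algebra_simps)
  have e2: "(\<lambda>x. snd (psi \<rho> \<nu> \<alpha> \<beta> (Suc t) x))
      = (\<lambda>x. (?r\<^sup>2 * ?a (x + 1) + (?r * cnj ?c) * ?b (x + 1))
           + ((- (1 - ?r\<^sup>2)) * ?a x + (?r * cnj ?c) * ?b x))"
    by (auto simp: Uop_def coinA_def coinB_def coinC_def Let_def)
  show "amp0 (Suc t) k = u11 k * amp0 t k + u12 k * amp1 t k"
    unfolding amp0_def amp1_def e1 fourier_add fourier_cmult sa sb u11_def u12_def
    by (simp add: algebra_simps)
  show "amp1 (Suc t) k = u21 k * amp0 t k + u22 k * amp1 t k"
    unfolding amp0_def amp1_def e2 fourier_add fourier_cmult sa sb u21_def u22_def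
    by (simp add: algebra_simps)
qed

abbreviation "r0 \<equiv> complex_of_real (rho0 \<rho>)"

lemma r0_sq: "r0\<^sup>2 = 1 - (complex_of_real \<rho>)\<^sup>2"
  using rho0(2) by (metis of_real_1 of_real_diff of_real_power)

text \<open>With \<open>z\<close> on the unit circle, \<open>R\<close> the square of \<rho> and
  \<open>1 - R\<close> the square of \<open>r0\<close>, both column norms and the determinant reduce
  to the single polynomial identity \<open>m\<close> below.\<close>

lemma u_norm: "(cmod (u11 k))\<^sup>2 + (cmod (u21 k))\<^sup>2 = 1" "(cmod (u12 k))\<^sup>2 + (cmod (u22 k))\<^sup>2 = 1"
  and u_orth: "cnj (u11 k) * u12 k + cnj (u21 k) * u22 k = 0"
  and u_det: "u11 k * u22 k - u12 k * u21 k = -1"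
proof -
  define z where "z = cis (k + \<nu>)"
  define a where "a = alpha0 \<rho> \<nu>"
  define R where "R = (complex_of_real \<rho>)\<^sup>2"
  have z: "cis (- (k + \<nu>)) = cnj z" "z * cnj z = 1" by (simp_all add: z_def cis_cnj cis_mult)
  have a: "a * cnj a = R" by (simp add: a_def R_def alpha0_def cis_cnj cis_mult power2_eq_square)
  have r: "r0 * r0 = 1 - R" using r0_sq by (simp add: R_def power2_eq_square)
  have cR: "cnj R = R" by (simp add: R_def)
  have u: "u11 k = - (a * r0 * (1 + cnj z))" "u12 k = - R + (1 - R) * cnj z"
    "u21 k = - R + (1 - R) * z" "u22 k = r0 * cnj a * (1 + z)"
    unfolding u11_def u12_def u21_def u22_def z(1) z_def[symmetric] a_def[symmetric] R_def
    by (simp_all add: r0_sq)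
  have n: "a * r0 * (1 + cnj z) * (r0 * cnj a * (1 + z)) = R * (1 - R) * (1 + cnj z) * (1 + z)"
  proof -
    have "a * r0 * (1 + cnj z) * (r0 * cnj a * (1 + z)) = (a * cnj a) * (r0 * r0) * (1 + cnj z) * (1 + z)"
      by (simp only: mult_ac)
    then show ?thesis unfolding a r .
  qed
  have m: "(- R + (1 - R) * z) * (- R + (1 - R) * cnj z) + R * (1 - R) * (1 + cnj z) * (1 + z) = 1"
    using z(2) by algebra
  have "complex_of_real ((cmod (u11 k))\<^sup>2 + (cmod (u21 k))\<^sup>2)
      = (- R + (1 - R) * z) * (- R + (1 - R) * cnj z) + a * r0 * (1 + cnj z) * (r0 * cnj a * (1 + z))"
    unfolding of_real_add complex_norm_square u using cR by (simp add: mult_ac)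
  also have "\<dots> = 1" unfolding n by (rule m)
  finally have "complex_of_real ((cmod (u11 k))\<^sup>2 + (cmod (u21 k))\<^sup>2) = 1" .
  then show "(cmod (u11 k))\<^sup>2 + (cmod (u21 k))\<^sup>2 = 1" using of_real_eq_1_iff by blast
  have "complex_of_real ((cmod (u12 k))\<^sup>2 + (cmod (u22 k))\<^sup>2)
      = (- R + (1 - R) * z) * (- R + (1 - R) * cnj z) + a * r0 * (1 + cnj z) * (r0 * cnj a * (1 + z))"
    unfolding of_real_add complex_norm_square u using cR by (simp add: mult_ac)
  also have "\<dots> = 1" unfolding n by (rule m)
  finally have "complex_of_real ((cmod (u12 k))\<^sup>2 + (cmod (u22 k))\<^sup>2) = 1" .
  then show "(cmod (u12 k))\<^sup>2 + (cmod (u22 k))\<^sup>2 = 1" using of_real_eq_1_iff by blast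
  show "u11 k * u22 k - u12 k * u21 k = -1" unfolding u using n m by algebra
  have "- (cnj a * r0 * (1 + z)) * (- R + (1 - R) * cnj z) + (- R + (1 - R) * cnj z) * (r0 * cnj a * (1 + z)) = 0"
    by algebra
  then show "cnj (u11 k) * u12 k + cnj (u21 k) * u22 k = 0" unfolding u using cR by simp
qed

text \<open>Together with determinant -1 this trace fixes the eigenvalues:
  \<open>\<i> * cis (phase k)\<close> and \<open>\<i> * cis (- phase k)\<close> have this sum, and
  product -1.\<close>

lemma u_trace: "u11 k + u22 k = 2 * \<i> * of_real (cos (phase k))"
proof -
  have s: "sin k = sin (k + \<nu>) * cos \<nu> - cos (k + \<nu>) * sin \<nu>" by (simp flip: sin_diff)
  have c: "cis (- (k + \<nu>)) = cnj (cis (k + \<nu>))" by (simp add: cis_cnj)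
  show ?thesis
    unfolding cos_phase u11_def u22_def alpha0_def s c
    by (simp add: complex_eq_iff algebra_simps)
qed

definition lp where "lp k = \<i> * cis (phase k)"
definition lm where "lm k = \<i> * cis (- phase k)"

lemma l_sum: "lp k + lm k = u11 k + u22 k"
  unfolding u_trace lp_def lm_def by (simp add: complex_eq_iff)

lemma l_prod: "lp k * lm k = -1"
proof -
  have "lp k * lm k = (\<i> * \<i>) * (cis (phase k) * cis (- phase k))"
    by (simp only: lp_def lm_def mult_ac)
  then show ?thesis by (simp add: cis_mult)
qed

lemma norm_l [simp]: "cmod (lp k) = 1" "cmod (lm k) = 1"
  by (simp_all add: lp_def lm_def norm_mult)

lemma l_diff: "lm k - lp k = of_real (2 * sphase k)"
  by (simp add: lp_def lm_def complex_eq_iff sin_phase)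

text \<open>Spectral projections of \<open>(\<alpha>, \<beta>)\<close>, the \<open>a\<close> part
  for \<open>lp\<close> and the \<open>b\<close> part for \<open>lm\<close>. Using
  \<open>(lm - M) / (lm - lp)\<close> and its counterpart, with M the symbol, avoids a choice of
  eigenvectors and makes continuity in \<open>k\<close> evident; \<open>lm - lp\<close> is
  \<open>2 * sphase k\<close>, never zero.\<close>

definition a1 where "a1 k = (lm k * \<alpha> - (u11 k * \<alpha> + u12 k * \<beta>)) / of_real (2 * sphase k)"
definition a2 where "a2 k = (lm k * \<beta> - (u21 k * \<alpha> + u22 k * \<beta>)) / of_real (2 * sphase k)"
definition b1 where "b1 k = ((u11 k * \<alpha> + u12 k * \<beta>) - lp k * \<alpha>) / of_real (2 * sphase k)"
definition b2 where "b2 k = ((u21 k * \<alpha> + u22 k * \<beta>) - lp k * \<beta>) / of_real (2 * sphase k)"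

lemma two_sphase_nonzero: "complex_of_real (2 * sphase k) \<noteq> 0"
  using sphase_pos[of k] by simp

lemma components_sum: "a1 k + b1 k = \<alpha>" "a2 k + b2 k = \<beta>"
proof -
  have "(a1 k + b1 k) * of_real (2 * sphase k) = \<alpha> * (lm k - lp k)"
    unfolding a1_def b1_def using two_sphase_nonzero[of k] by (simp add: field_simps)
  then show "a1 k + b1 k = \<alpha>" unfolding l_diff using two_sphase_nonzero[of k] by simp
  have "(a2 k + b2 k) * of_real (2 * sphase k) = \<beta> * (lm k - lp k)"
    unfolding a2_def b2_def using two_sphase_nonzero[of k] by (simp add: field_simps)
  then show "a2 k + b2 k = \<beta>" unfolding l_diff using two_sphase_nonzero[of k] by simp
qed

lemma eigen_a: "u11 k * a1 k + u12 k * a2 k = lp k * a1 k" "u21 k * a1 k + u22 k * a2 k = lp k * a2 k"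
proof -
  note e = eigen_aux[OF l_sum l_prod u_det, of k \<alpha> \<beta>]
  show "u11 k * a1 k + u12 k * a2 k = lp k * a1 k" "u21 k * a1 k + u22 k * a2 k = lp k * a2 k"
    unfolding a1_def a2_def times_divide_eq_right add_divide_distrib[symmetric] e by simp_all
qed

lemma eigen_b: "u11 k * b1 k + u12 k * b2 k = lm k * b1 k" "u21 k * b1 k + u22 k * b2 k = lm k * b2 k"
proof -
  have s: "lm k + lp k = u11 k + u22 k" "lm k * lp k = -1"
    using l_sum[of k] l_prod[of k] by (simp_all add: add.commute mult.commute)
  note e = eigen_aux[OF s u_det, of \<alpha> \<beta>]
  have neg: "b1 k = - ((lp k * \<alpha> - (u11 k * \<alpha> + u12 k * \<beta>)) / of_real (2 * sphase k))"
    "b2 k = - ((lp k * \<beta> - (u21 k * \<alpha> + u22 k * \<beta>)) / of_real (2 * sphase k))"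
    by (simp_all add: b1_def b2_def minus_divide_left)
  show "u11 k * b1 k + u12 k * b2 k = lm k * b1 k" "u21 k * b1 k + u22 k * b2 k = lm k * b2 k"
    unfolding neg mult_minus_right times_divide_eq_right minus_add_distrib[symmetric]
      add_divide_distrib[symmetric] e by simp_all
qed

lemma f_closed: "amp0 t k = lp k ^ t * a1 k + lm k ^ t * b1 k" "amp1 t k = lp k ^ t * a2 k + lm k ^ t * b2 k"
proof (induction t)
  case 0
  { case 1 show ?case by (simp add: f_0 components_sum) }
  { case 2 show ?case by (simp add: f_0 components_sum) }
next
  case (Suc t)
  { case 1
    have "amp0 (Suc t) k = lp k ^ t * (u11 k * a1 k + u12 k * a2 k) + lm k ^ t * (u11 k * b1 k + u12 k * b2 k)"
      unfolding f_Suc Suc by (simp add: algebra_simps)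
    then show ?case unfolding eigen_a eigen_b by simp }
  { case 2
    have "amp1 (Suc t) k = lp k ^ t * (u21 k * a1 k + u22 k * a2 k) + lm k ^ t * (u21 k * b1 k + u22 k * b2 k)"
      unfolding f_Suc Suc by (simp add: algebra_simps)
    then show ?case unfolding eigen_a eigen_b by simp }
qed

lemma f_norm: "(cmod (amp0 t k))\<^sup>2 + (cmod (amp1 t k))\<^sup>2 = 1"
proof (induction t)
  case 0
  then show ?case by (simp add: f_0 unit)
next
  case (Suc t)
  have "complex_of_real ((cmod (amp0 (Suc t) k))\<^sup>2 + (cmod (amp1 (Suc t) k))\<^sup>2)
      = cnj (amp0 (Suc t) k) * amp0 (Suc t) k + cnj (amp1 (Suc t) k) * amp1 (Suc t) k"
    by (simp add: cnj_mult_self)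
  also have "\<dots> = cnj (amp0 t k) * amp0 t k + cnj (amp1 t k) * amp1 t k"
    unfolding f_Suc by (rule unitary_2x2_cinner[OF u_norm u_orth])
  also have "\<dots> = complex_of_real ((cmod (amp0 t k))\<^sup>2 + (cmod (amp1 t k))\<^sup>2)"
    by (simp add: cnj_mult_self)
  finally show ?case using Suc of_real_eq_iff by (metis of_real_1)
qed

text \<open>Eigenvectors of a unitary matrix for distinct eigenvalues: invariance multiplies the
  inner product by \<open>cnj (lp k) * lm k\<close>, and \<open>lp k\<close> differs from
  \<open>lm k\<close> because \<open>sphase k\<close> is positive.\<close>

lemma components_orth: "cnj (a1 k) * b1 k + cnj (a2 k) * b2 k = 0"
proof -
  let ?I = "cnj (a1 k) * b1 k + cnj (a2 k) * b2 k"
  have "?I = cnj (lp k * a1 k) * (lm k * b1 k) + cnj (lp k * a2 k) * (lm k * b2 k)"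
    using unitary_2x2_cinner[OF u_norm u_orth, of k "a1 k" "a2 k" "b1 k" "b2 k"]
    unfolding eigen_a eigen_b by simp
  also have "\<dots> = cnj (lp k) * lm k * ?I" by (simp add: algebra_simps)
  finally have I: "?I = cnj (lp k) * lm k * ?I" .
  have "lp k * ?I = (cnj (lp k) * lp k) * lm k * ?I" by (subst I) (simp only: mult_ac)
  then have "lp k * ?I = lm k * ?I" unfolding cnj_mult_self norm_l by simp
  then have "(lm k - lp k) * ?I = 0" unfolding left_diff_distrib by (simp only: diff_self)
  then show ?thesis unfolding l_diff using two_sphase_nonzero[of k] by simp
qed

section \<open>Spectral weights and their behaviour under reflection\<close>

definition wp where "wp k = cnj (a1 k) * a1 k + cnj (a2 k) * a2 k"
definition wm where "wm k = cnj (b1 k) * b1 k + cnj (b2 k) * b2 k"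

lemma unit_cnj: "cnj \<alpha> * \<alpha> + cnj \<beta> * \<beta> = 1"
  unfolding cnj_mult_self of_real_add[symmetric] unit by simp

text \<open>Orthogonality replaces the squared norm of the component by its inner product with
  \<open>(\<alpha>, \<beta>)\<close>. The numerator is then affine in the entries of the symbol and
  the eigenvalue, so reflected values can be subtracted entrywise.\<close>

lemma wm_eq: "wm k = (cnj \<alpha> * (u11 k * \<alpha> + u12 k * \<beta>) + cnj \<beta> * (u21 k * \<alpha> + u22 k * \<beta>) - lp k) / of_real (2 * sphase k)"
proof -
  have "wm k = cnj (a1 k + b1 k) * b1 k + cnj (a2 k + b2 k) * b2 k"
    using components_orth[of k] by (simp add: wm_def algebra_simps)
  also have "\<dots> = cnj \<alpha> * b1 k + cnj \<beta> * b2 k" unfolding components_sum ..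
  also have "\<dots> = (cnj \<alpha> * (u11 k * \<alpha> + u12 k * \<beta>) + cnj \<beta> * (u21 k * \<alpha> + u22 k * \<beta>)
      - lp k * (cnj \<alpha> * \<alpha> + cnj \<beta> * \<beta>)) / of_real (2 * sphase k)"
    unfolding b1_def b2_def times_divide_eq_right add_divide_distrib[symmetric]
    by (rule arg_cong2[of _ _ _ _ "(/)"]) (simp_all add: algebra_simps)
  finally show ?thesis unfolding unit_cnj by simp
qed

lemma wp_eq: "wp k = (lm k - (cnj \<alpha> * (u11 k * \<alpha> + u12 k * \<beta>) + cnj \<beta> * (u21 k * \<alpha> + u22 k * \<beta>))) / of_real (2 * sphase k)"
proof -
  have "cnj (b1 k) * a1 k + cnj (b2 k) * a2 k = 0"
    using arg_cong[OF components_orth[of k], of cnj] by (simp add: mult.commute)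
  then have "wp k = cnj (a1 k + b1 k) * a1 k + cnj (a2 k + b2 k) * a2 k"
    by (simp add: wp_def algebra_simps)
  also have "\<dots> = cnj \<alpha> * a1 k + cnj \<beta> * a2 k" unfolding components_sum ..
  also have "\<dots> = (lm k * (cnj \<alpha> * \<alpha> + cnj \<beta> * \<beta>) - (cnj \<alpha> * (u11 k * \<alpha> + u12 k * \<beta>) + cnj \<beta> * (u21 k * \<alpha> + u22 k * \<beta>))
      ) / of_real (2 * sphase k)"
    unfolding a1_def a2_def times_divide_eq_right add_divide_distrib[symmetric]
    by (rule arg_cong2[of _ _ _ _ "(/)"]) (simp_all add: algebra_simps)
  finally show ?thesis unfolding unit_cnj by simp
qed

lemma reflect: "sphase (pi - k) = sphase k" "vel (pi - k) = - vel k" "phase (pi - k) = phase k"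
  by (simp_all add: sphase_def vel_def phase_def)

lemma u_reflect:
  "u11 k - u11 (pi - k) = - of_real (2 * cos k * (\<rho> * rho0 \<rho>))"
  "u12 k - u12 (pi - k) = of_real (2 * cos k * (rho0 \<rho>)\<^sup>2) * cis (- \<nu>)"
  "u21 k - u21 (pi - k) = of_real (2 * cos k * (rho0 \<rho>)\<^sup>2) * cis \<nu>"
  "u22 k - u22 (pi - k) = of_real (2 * cos k * (\<rho> * rho0 \<rho>))"
proof -
  have 1: "cis (pi - k + \<nu>) = - cis (- k) * cis \<nu>"
    by (simp add: cis_mult complex_eq_iff cos_add sin_add cos_diff sin_diff)
  have 2: "cis (- (pi - k + \<nu>)) = - cis k * cis (- \<nu>)"
    by (simp add: cis_mult complex_eq_iff cos_add sin_add cos_diff sin_diff)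
  have 3: "cis (k + \<nu>) = cis k * cis \<nu>" "cis (- (k + \<nu>)) = cis (- k) * cis (- \<nu>)"
    by (simp_all add: cis_mult)
  have c: "cis k + cis (- k) = of_real (2 * cos k)" by (simp add: complex_eq_iff)
  have n: "cis \<nu> * cis (- \<nu>) = 1" by (simp add: cis_mult)
  have al: "alpha0 \<rho> \<nu> = of_real \<rho> * cis \<nu>" "cnj (alpha0 \<rho> \<nu>) = of_real \<rho> * cis (- \<nu>)"
    by (simp_all add: alpha0_def cis_cnj)
  show "u11 k - u11 (pi - k) = - of_real (2 * cos k * (\<rho> * rho0 \<rho>))"
    unfolding u11_def 1 2 3 al of_real_mult[of "2 * cos k"] c[symmetric] of_real_mult[of \<rho>]
    using n by algebra
  show "u12 k - u12 (pi - k) = of_real (2 * cos k * (rho0 \<rho>)\<^sup>2) * cis (- \<nu>)"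
    unfolding u12_def 1 2 3 al of_real_mult[of "2 * cos k"] c[symmetric] of_real_power
    by algebra
  show "u21 k - u21 (pi - k) = of_real (2 * cos k * (rho0 \<rho>)\<^sup>2) * cis \<nu>"
    unfolding u21_def 1 2 3 al of_real_mult[of "2 * cos k"] c[symmetric] of_real_power
    by algebra
  show "u22 k - u22 (pi - k) = of_real (2 * cos k * (\<rho> * rho0 \<rho>))"
    unfolding u22_def al(2) 1 2 3 of_real_mult[of "2 * cos k"] c[symmetric] of_real_mult[of \<rho>]
    using n by algebra
qed

text \<open>The reflection fixes \<open>phase\<close> and \<open>sphase\<close>, so the eigenvalues
  contribute \<open>lm - lp\<close>, that is 1 after division, and the matrix entries only their
  differences from \<open>u_reflect\<close>. These all carry \<open>cos k\<close>, which over
  \<open>sphase k\<close> is a constant multiple of \<open>vel k\<close>.\<close>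

lemma weight_sum: "wm k + wp (pi - k) = of_real (gamma_w \<rho> \<nu> \<alpha> \<beta> (vel k))"
proof -
  let ?D = "sphase k" and ?c = "Re (\<alpha> * cnj \<beta>) * cos \<nu> - Im (\<alpha> * cnj \<beta>) * sin \<nu>"
  let ?d = "\<lambda>u. u k - u (pi - k)"
  have "wm k + wp (pi - k) = ((lm k - lp k)
      + (cnj \<alpha> * (?d u11 * \<alpha> + ?d u12 * \<beta>) + cnj \<beta> * (?d u21 * \<alpha> + ?d u22 * \<beta>))) / of_real (2 * ?D)"
    unfolding wm_eq wp_eq reflect lp_def lm_def add_divide_distrib[symmetric]
    by (rule arg_cong2[of _ _ _ _ "(/)"]) (simp_all add: algebra_simps)
  also have "cnj \<alpha> * (?d u11 * \<alpha> + ?d u12 * \<beta>) + cnj \<beta> * (?d u21 * \<alpha> + ?d u22 * \<beta>)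
     = of_real (2 * cos k * (\<rho> * rho0 \<rho> * ((cmod \<beta>)\<^sup>2 - (cmod \<alpha>)\<^sup>2) + 2 * (rho0 \<rho>)\<^sup>2 * ?c))"
    unfolding u_reflect cmod_power2
    by (simp add: complex_eq_iff power2_eq_square algebra_simps)
  also have "(lm k - lp k + of_real (2 * cos k * (\<rho> * rho0 \<rho> * ((cmod \<beta>)\<^sup>2 - (cmod \<alpha>)\<^sup>2) + 2 * (rho0 \<rho>)\<^sup>2 * ?c)))
      / of_real (2 * ?D)
     = of_real ((2 * ?D + 2 * cos k * (\<rho> * rho0 \<rho> * ((cmod \<beta>)\<^sup>2 - (cmod \<alpha>)\<^sup>2) + 2 * (rho0 \<rho>)\<^sup>2 * ?c)) / (2 * ?D))"
    unfolding l_diff of_real_divide of_real_add ..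
  also have "(2 * ?D + 2 * cos k * (\<rho> * rho0 \<rho> * ((cmod \<beta>)\<^sup>2 - (cmod \<alpha>)\<^sup>2) + 2 * (rho0 \<rho>)\<^sup>2 * ?c)) / (2 * ?D)
     = gamma_w \<rho> \<nu> \<alpha> \<beta> (vel k)"
    unfolding gamma_w_def vel_def using sphase_pos[of k] rho
    by (simp add: field_simps power2_eq_square)
  finally show ?thesis .
qed

subsection \<open>Convergence of the characteristic functions\<close>

lemma prob_at_eq: "prob_at \<rho> \<nu> \<alpha> \<beta> t x
    = (cmod (fst (psi \<rho> \<nu> \<alpha> \<beta> t x)))\<^sup>2 + (cmod (snd (psi \<rho> \<nu> \<alpha> \<beta> t x)))\<^sup>2"
  by (simp add: prob_at_def Let_def)

lemma prob_at_nonneg: "0 \<le> prob_at \<rho> \<nu> \<alpha> \<beta> t x"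
  by (simp add: prob_at_eq)

lemma prob_at_support: "x \<notin> {- int t..int t} \<Longrightarrow> prob_at \<rho> \<nu> \<alpha> \<beta> t x = 0"
  using psi_support[of t x] by (auto simp: prob_at_eq)

definition overlap where
  "overlap t d k = cnj (amp0 t k) * amp0 t (k - d) + cnj (amp1 t k) * amp1 t (k - d)"

lemma overlap_has_integral:
  "(overlap t d has_integral of_real (2 * pi) *
     (\<Sum>x\<in>{- int t..int t}. of_real (prob_at \<rho> \<nu> \<alpha> \<beta> t x) * cis (d * of_int x))) {c..c + 2 * pi}"
proof -
  have "((\<lambda>k. overlap t d k) has_integral of_real (2 * pi) *
     (\<Sum>x\<in>{- int t..int t}. of_real ((cmod (fst (psi \<rho> \<nu> \<alpha> \<beta> t x)))\<^sup>2) * cis (d * of_int x)) +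
     of_real (2 * pi) *
     (\<Sum>x\<in>{- int t..int t}. of_real ((cmod (snd (psi \<rho> \<nu> \<alpha> \<beta> t x)))\<^sup>2) * cis (d * of_int x))) {c..c + 2 * pi}"
    unfolding overlap_def amp0_def amp1_def diff_add_eq
    by (intro has_integral_add parseval_shift)
  then show ?thesis
    by (simp add: prob_at_eq sum.distrib distrib_right distrib_left)
qed

lemma sum_prob_at: "(\<Sum>x\<in>{- int t..int t}. prob_at \<rho> \<nu> \<alpha> \<beta> t x) = 1"
proof -
  have "overlap t 0 = (\<lambda>k. 1)"
    by (rule ext) (unfold overlap_def diff_0_right cnj_mult_self of_real_add[symmetric] f_norm, simp)
  then have "((\<lambda>k. 1) has_integral of_real (2 * pi) *
     complex_of_real (\<Sum>x\<in>{- int t..int t}. prob_at \<rho> \<nu> \<alpha> \<beta> t x)) {0..0 + 2 * pi}"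
    using overlap_has_integral[of t 0 0] by simp
  moreover have "((\<lambda>k. 1) has_integral complex_of_real (2 * pi)) {0..0 + 2 * pi}"
    using has_integral_const_real[of "1::complex" 0 "0 + 2 * pi"] by (simp add: scaleR_conv_of_real)
  ultimately have "complex_of_real (2 * pi) * of_real (\<Sum>x\<in>{- int t..int t}. prob_at \<rho> \<nu> \<alpha> \<beta> t x) = of_real (2 * pi) * of_real 1"
    unfolding of_real_1 mult_1_right by (rule has_integral_unique)
  then show ?thesis by (simp flip: of_real_sum)
qed

lemma continuous_eigen:
  "continuous_on UNIV a1" "continuous_on UNIV a2" "continuous_on UNIV b1" "continuous_on UNIV b2"
proof -
  have l: "continuous_on UNIV lp" "continuous_on UNIV lm"
    unfolding lp_def lm_def by (intro continuous_intros continuous_on_phase)+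
  have u: "continuous_on UNIV u11" "continuous_on UNIV u12" "continuous_on UNIV u21" "continuous_on UNIV u22"
    unfolding u11_def u12_def u21_def u22_def by (intro continuous_intros)+
  show "continuous_on UNIV a1" "continuous_on UNIV a2" "continuous_on UNIV b1" "continuous_on UNIV b2"
    unfolding a1_def a2_def b1_def b2_def
    by (intro continuous_intros continuous_on_sphase l u ballI two_sphase_nonzero)+
qed

lemma continuous_weights: "continuous_on UNIV wp" "continuous_on UNIV wm"
  unfolding wp_def wm_def by (intro continuous_intros continuous_eigen)+

lemma overlap_closed:
  "overlap t d k = (cnj (lp k) * lp (k - d)) ^ t * (cnj (a1 k) * a1 (k - d) + cnj (a2 k) * a2 (k - d))
    + (cnj (lm k) * lm (k - d)) ^ t * (cnj (b1 k) * b1 (k - d) + cnj (b2 k) * b2 (k - d))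
    + (cnj (lp k) * lm (k - d)) ^ t * (cnj (a1 k) * b1 (k - d) + cnj (a2 k) * b2 (k - d))
    + (cnj (lm k) * lp (k - d)) ^ t * (cnj (b1 k) * a1 (k - d) + cnj (b2 k) * a2 (k - d))"
  unfolding overlap_def f_closed by (simp add: power_mult_distrib algebra_simps)

text \<open>The \<open>t\<close>-th power of an eigenvalue ratio has this exponent up to sign; the
  limit is one of difference quotients of \<open>phase\<close>, which is how the group velocity
  arises.\<close>

lemma phase_increment:
  "(\<lambda>t. real t * (phase (k - \<xi> / real t) - phase k)) \<longlonglongrightarrow> - \<xi> * vel k"
proof -
  have "((\<lambda>h. phase (k - \<xi> * h)) has_real_derivative vel (k - \<xi> * 0) * (- \<xi>)) (at 0)"
    by (rule DERIV_chain2[OF phase_deriv]) (auto intro!: derivative_eq_intros)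
  then have "((\<lambda>h. (phase (k - \<xi> * h) - phase k) / h) \<longlongrightarrow> - \<xi> * vel k) (at 0)"
    by (simp add: DERIV_def mult.commute)
  moreover have "filterlim (\<lambda>t. 1 / real t) (at 0) sequentially"
    by (auto simp: filterlim_at eventually_at_top_linorder intro!: lim_1_over_n exI[of _ 1])
  ultimately have "(\<lambda>t. (phase (k - \<xi> * (1 / real t)) - phase k) / (1 / real t)) \<longlonglongrightarrow> - \<xi> * vel k"
    by (rule filterlim_compose)
  then show ?thesis by (simp add: mult.commute)
qed

lemma overlap_tendsto:
  "(\<lambda>t. overlap t (\<xi> / real t) k) \<longlonglongrightarrow> cis (- \<xi> * vel k) * wp k + cis (\<xi> * vel k) * wm k"
proof -
  have "(\<lambda>t. k - \<xi> / real t) \<longlonglongrightarrow> k - 0"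
    by (intro tendsto_diff tendsto_const lim_const_over_n)
  then have d: "(\<lambda>t. k - \<xi> / real t) \<longlonglongrightarrow> k" by simp
  have tend: "(\<lambda>t. g (k - \<xi> / real t)) \<longlonglongrightarrow> g k" if "continuous_on UNIV g" for g :: "real \<Rightarrow> complex"
    using that d by (intro continuous_on_tendsto_compose[of UNIV g]) auto
  note ab = continuous_eigen[THEN tend]
  have pw: "(cnj (lp k) * lp (k - e)) ^ t = cis (real t * (phase (k - e) - phase k))"
    "(cnj (lm k) * lm (k - e)) ^ t = cis (- (real t * (phase (k - e) - phase k)))" for t e
    unfolding lp_def lm_def by (simp_all add: cis_cnj cis_mult Complex.DeMoivre algebra_simps)
  have cis_tend: "(\<lambda>t. cis (x t)) \<longlonglongrightarrow> cis l" if "x \<longlonglongrightarrow> l" for x :: "nat \<Rightarrow> real" and l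
    using that by (intro continuous_on_tendsto_compose[of UNIV cis]) (auto intro!: continuous_intros)
  \<comment> \<open>The powers in the mixed terms are unimodular but need not converge. The
    accompanying inner products tend to zero by orthogonality, which disposes of these
    terms.\<close>
  have zero: "(\<lambda>t. c t ^ t * y t) \<longlonglongrightarrow> 0" if "y \<longlonglongrightarrow> 0" "\<And>t. cmod (c t) = 1" for c y :: "nat \<Rightarrow> complex"
    using that by (simp add: tendsto_norm_zero_iff[symmetric, where f = "\<lambda>t. c t ^ t * y t"]
        tendsto_norm_zero_iff norm_mult norm_power tendsto_norm_zero)
  have orth': "cnj (b1 k) * a1 k + cnj (b2 k) * a2 k = 0"
    using arg_cong[OF components_orth[of k], of cnj] by (simp add: mult.commute)
  have 1: "(\<lambda>t. (cnj (lp k) * lp (k - \<xi> / real t)) ^ t * (cnj (a1 k) * a1 (k - \<xi> / real t) + cnj (a2 k) * a2 (k - \<xi> / real t)))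
      \<longlonglongrightarrow> cis (- \<xi> * vel k) * wp k"
    unfolding wp_def pw by (intro tendsto_mult tendsto_add tendsto_const ab cis_tend phase_increment)
  have 2: "(\<lambda>t. (cnj (lm k) * lm (k - \<xi> / real t)) ^ t * (cnj (b1 k) * b1 (k - \<xi> / real t) + cnj (b2 k) * b2 (k - \<xi> / real t)))
      \<longlonglongrightarrow> cis (- (- \<xi> * vel k)) * wm k"
    unfolding wm_def pw by (intro tendsto_mult tendsto_add tendsto_const ab cis_tend tendsto_minus phase_increment)
  have "(\<lambda>t. cnj (a1 k) * b1 (k - \<xi> / real t) + cnj (a2 k) * b2 (k - \<xi> / real t)) \<longlonglongrightarrow> cnj (a1 k) * b1 k + cnj (a2 k) * b2 k"
    by (intro tendsto_mult tendsto_add tendsto_const ab)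
  then have 3: "(\<lambda>t. (cnj (lp k) * lm (k - \<xi> / real t)) ^ t * (cnj (a1 k) * b1 (k - \<xi> / real t) + cnj (a2 k) * b2 (k - \<xi> / real t))) \<longlonglongrightarrow> 0"
    unfolding components_orth by (intro zero) (auto simp: norm_mult)
  have "(\<lambda>t. cnj (b1 k) * a1 (k - \<xi> / real t) + cnj (b2 k) * a2 (k - \<xi> / real t)) \<longlonglongrightarrow> cnj (b1 k) * a1 k + cnj (b2 k) * a2 k"
    by (intro tendsto_mult tendsto_add tendsto_const ab)
  then have 4: "(\<lambda>t. (cnj (lm k) * lp (k - \<xi> / real t)) ^ t * (cnj (b1 k) * a1 (k - \<xi> / real t) + cnj (b2 k) * a2 (k - \<xi> / real t))) \<longlonglongrightarrow> 0"
    unfolding orth' by (intro zero) (auto simp: norm_mult)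
  show ?thesis
    unfolding overlap_closed using tendsto_add[OF tendsto_add[OF tendsto_add[OF 1 2] 3] 4] by simp
qed

abbreviation "tilted \<xi> \<equiv> (\<lambda>y. gamma_w \<rho> \<nu> \<alpha> \<beta> y *\<^sub>R cis (\<xi> * y))"

lemma continuous_tilted: "continuous_on UNIV (tilted \<xi>)"
  unfolding gamma_w_def by (intro continuous_intros)

lemma char_tendsto:
  "(\<lambda>t. \<Sum>x\<in>{- int t..int t}. of_real (prob_at \<rho> \<nu> \<alpha> \<beta> t x) * cis (\<xi> / real t * of_int x))
     \<longlonglongrightarrow> integral {- (pi / 2)..- (pi / 2) + 2 * pi} (\<lambda>k. tilted \<xi> (vel k)) / of_real (2 * pi)"
proof -
  \<comment> \<open>A period centred at \<open>pi / 2\<close>, so that the reflection of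
    \<open>k\<close> to \<open>pi - k\<close> maps it onto itself.\<close>
  let ?J = "{- (pi / 2)..- (pi / 2) + 2 * pi}"
  let ?P = "\<lambda>k. cis (- \<xi> * vel k) * wp k" and ?M = "\<lambda>k. cis (\<xi> * vel k) * wm k"
  have cP: "continuous_on A ?P" and cM: "continuous_on A ?M" for A
    by (intro continuous_intros continuous_on_vel continuous_on_subset[OF continuous_weights(1)]
        continuous_on_subset[OF continuous_weights(2)] subset_UNIV)+
  have "(\<lambda>t. integral ?J (overlap t (\<xi> / real t))) \<longlonglongrightarrow> integral ?J (\<lambda>k. ?P k + ?M k)"
  proof (rule dominated_convergence(2)[where h = "\<lambda>_. 1"])
    show "overlap t (\<xi> / real t) integrable_on ?J" for t
      using overlap_has_integral by blast
    show "norm (overlap t (\<xi> / real t) k) \<le> 1" for t k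
      unfolding overlap_def by (intro cinner_bound f_norm)
  qed (use overlap_tendsto in auto)
  also have "integral ?J (\<lambda>k. ?P k + ?M k) = integral ?J ?P + integral ?J ?M"
    by (intro integral_add integrable_continuous_real cP cM)
  also have "integral ?J ?P = integral ?J (\<lambda>k. ?P (pi - k))"
    using integral_reflect_about[of pi "- (pi / 2) + 2 * pi" "- (pi / 2)" ?P] by simp
  also have "\<dots> + integral ?J ?M = integral ?J (\<lambda>k. ?P (pi - k) + ?M k)"
    by (intro integral_add[symmetric] integrable_continuous_real cM
        continuous_on_compose_UNIV[OF cP] continuous_intros)
  also have "(\<lambda>k. ?P (pi - k) + ?M k) = (\<lambda>k. tilted \<xi> (vel k))"
  proof
    fix k
    have "?P (pi - k) + ?M k = cis (\<xi> * vel k) * (wm k + wp (pi - k))"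
      by (simp add: reflect algebra_simps)
    then show "?P (pi - k) + ?M k = tilted \<xi> (vel k)"
      unfolding weight_sum by (simp add: scaleR_conv_of_real mult.commute)
  qed
  finally have "(\<lambda>t. integral ?J (overlap t (\<xi> / real t)) / of_real (2 * pi))
     \<longlonglongrightarrow> integral ?J (\<lambda>k. tilted \<xi> (vel k)) / of_real (2 * pi)"
    by (intro tendsto_divide tendsto_const) auto
  then show ?thesis
    unfolding integral_unique[OF overlap_has_integral] by simp
qed

subsection \<open>The limit law\<close>

text \<open>Replacing \<open>k\<close> by \<open>-k\<close> amounts to replacing \<open>sin \<nu>\<close> by \<open>- sin \<nu>\<close>: it exchanges the two arcs of
  monotonicity of \<open>vel\<close>, and \<open>\<eta>\<^sub>+\<close> with \<open>\<eta>\<^sub>-\<close>.\<close>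

lemma mirror_band: "band (\<rho> * rho0 \<rho>) (- sin \<nu>)"
  using p_pos p_le s_le gap by unfold_locales auto

interpretation mirror: band "\<rho> * rho0 \<rho>" "- sin \<nu>"
  by (rule mirror_band)

lemma xi_eq: "xi \<rho> \<nu> x = disc x"
proof -
  \<comment> \<open>The leading 1 in the middle coefficient of \<open>disc\<close> is split as the
    sum of the squares of \<rho> and \<open>rho0 \<rho>\<close>, to match the expanded product in
    \<open>xi\<close>.\<close>
  have "disc x = (x\<^sup>2)\<^sup>2 - (\<rho>\<^sup>2 + (rho0 \<rho>)\<^sup>2 + \<rho>\<^sup>2 * (rho0 \<rho>)\<^sup>2 * (1 - (sin \<nu>)\<^sup>2)) * x\<^sup>2 + \<rho>\<^sup>2 * (rho0 \<rho>)\<^sup>2"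
    unfolding disc_def rho0(2) by (simp add: power_mult_distrib rho0(2))
  then show ?thesis unfolding xi_def cos_squared_eq by (simp add: algebra_simps power2_eq_square)
qed

lemma mirror_eq: "mirror.disc = disc" "mirror.vmax = vmax" "mirror.vel k = vel (- k)" "mirror.crit (- u) = - crit u"
  by (simp_all add: fun_eq_iff mirror.disc_def disc_def mirror.vmax_def vmax_def mirror.vel_def vel_def
      mirror.sphase_def sphase_def mirror.crit_def crit_def power2_eq_square algebra_simps)

lemma hstar_eq: "hstar \<rho> \<nu> = vmax"
  by (simp add: hstar_def vmax_def power_mult_distrib)

lemma eta_eq: "eta_plus \<rho> \<nu> x = branch x" "eta_minus \<rho> \<nu> x = mirror.branch x"
  unfolding eta_plus_def eta_minus_def branch_def mirror.branch_def xi_eq mirror_eq cos_squared_eq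
  by (simp_all add: power_mult_distrib)

lemma limit_density_eq:
  "limit_density \<rho> \<nu> \<alpha> \<beta> y = (push_density y + mirror.push_density y) * gamma_w \<rho> \<nu> \<alpha> \<beta> y / (2 * pi)"
  unfolding limit_density_def push_density_def mirror.push_density_def eta_eq xi_eq mirror_eq hstar_eq
  by (simp add: add_divide_distrib field_simps split: split_indicator)

text \<open>If \<open>y^2\<close> were at least \<open>\<rho>^2\<close>, positivity of
  \<open>xi\<close> would push it above the square of \<open>rho0 \<rho>\<close> as well; then
  \<open>y^2\<close> would be at least \<open>\<rho> * rho0 \<rho>\<close>, against
  \<open>abs_less_vmax\<close>.\<close>

lemma vmax_le_rho:
  assumes "\<bar>y\<bar> < vmax"
  shows "\<bar>y\<bar> < \<rho>"
proof (rule ccontr)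
  assume "\<not> \<bar>y\<bar> < \<rho>"
  then have 1: "\<rho>\<^sup>2 \<le> y\<^sup>2" using rho by (simp add: abs_le_square_iff[symmetric])
  note y = abs_less_vmax[OF assms]
  have "0 < xi \<rho> \<nu> y" using y(1) by (simp add: xi_eq)
  moreover have "0 \<le> \<rho>\<^sup>2 * (rho0 \<rho>)\<^sup>2 * (cos \<nu>)\<^sup>2 * y\<^sup>2" by simp
  ultimately have "0 < (\<rho>\<^sup>2 - y\<^sup>2) * ((rho0 \<rho>)\<^sup>2 - y\<^sup>2)" unfolding xi_def by linarith
  then have 2: "(rho0 \<rho>)\<^sup>2 < y\<^sup>2" using 1 by (auto simp: zero_less_mult_iff)
  have "\<rho>\<^sup>2 * (rho0 \<rho>)\<^sup>2 \<le> y\<^sup>2 * y\<^sup>2" using 1 2 by (intro mult_mono) auto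
  moreover have "y\<^sup>2 * y\<^sup>2 < (\<rho> * rho0 \<rho>) * (\<rho> * rho0 \<rho>)"
    using y(2) p_pos by (intro mult_strict_mono) auto
  ultimately show False by (simp add: power2_eq_square mult_ac)
qed

text \<open>The slope of \<gamma> is \<open>(\<rho> * X - 2 * rho0 \<rho> * C) / \<rho>\<close>.
  Normalisation of the initial state gives \<open>X^2 + 4 * C^2 \<le> 1\<close>, and Lagrange's
  identity with the unit vector \<open>(\<rho>, rho0 \<rho>)\<close> bounds the numerator by 1,
  while \<open>\<bar>y\<bar> < \<rho>\<close>.\<close>

lemma gamma_nonneg:
  assumes "\<bar>y\<bar> < vmax"
  shows "0 \<le> gamma_w \<rho> \<nu> \<alpha> \<beta> y"
proof -
  define C where "C = Re (\<alpha> * cnj \<beta>) * cos \<nu> - Im (\<alpha> * cnj \<beta>) * sin \<nu>"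
  define X where "X = (cmod \<alpha>)\<^sup>2 - (cmod \<beta>)\<^sup>2"
  have "C = Re (\<alpha> * cnj \<beta> * cis \<nu>)" by (simp add: C_def)
  then have "\<bar>C\<bar> \<le> cmod \<alpha> * cmod \<beta>" using abs_Re_le_cmod[of "\<alpha> * cnj \<beta> * cis \<nu>"] by (simp add: norm_mult)
  then have "C\<^sup>2 \<le> (cmod \<alpha> * cmod \<beta>)\<^sup>2" by (rule power2_le_iff_abs_le[THEN iffD2, rotated]) simp
  then have "X\<^sup>2 + 4 * C\<^sup>2 \<le> ((cmod \<alpha>)\<^sup>2 + (cmod \<beta>)\<^sup>2)\<^sup>2"
    unfolding X_def by (simp add: power2_eq_square algebra_simps)
  then have 1: "X\<^sup>2 + 4 * C\<^sup>2 \<le> 1" unfolding unit by simp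
  have "(\<rho> * X - 2 * rho0 \<rho> * C)\<^sup>2 + (rho0 \<rho> * X + 2 * \<rho> * C)\<^sup>2 = (\<rho>\<^sup>2 + (rho0 \<rho>)\<^sup>2) * (X\<^sup>2 + 4 * C\<^sup>2)"
    by (simp add: power2_eq_square algebra_simps)
  then have "(\<rho> * X - 2 * rho0 \<rho> * C)\<^sup>2 \<le> 1" using 1 rho0(2) by (smt (verit) mult_cancel_right1 zero_le_power2)
  then have A: "\<bar>\<rho> * X - 2 * rho0 \<rho> * C\<bar> \<le> 1" by (simp add: abs_square_le_1)
  have "\<bar>(\<rho> * X - 2 * rho0 \<rho> * C) * y\<bar> \<le> 1 * \<rho>"
    unfolding abs_mult using A vmax_le_rho[OF assms] by (intro mult_mono) auto
  then have "0 \<le> (\<rho> + (\<rho> * X - 2 * rho0 \<rho> * C) * y) / \<rho>" using rho by (intro divide_nonneg_pos) auto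
  also have "\<dots> = gamma_w \<rho> \<nu> \<alpha> \<beta> y"
    unfolding gamma_w_def C_def[symmetric] X_def[symmetric] using rho by (simp add: field_simps)
  finally show ?thesis .
qed

lemma limit_density_nonneg: "0 \<le> limit_density \<rho> \<nu> \<alpha> \<beta> y"
proof (cases "\<bar>y\<bar> < vmax")
  case True
  then show ?thesis
    unfolding limit_density_eq using gamma_nonneg push_density_nonneg mirror.push_density_nonneg by simp
next
  case False
  then show ?thesis by (auto simp: limit_density_def hstar_eq abs_less_iff split: split_indicator)
qed

lemma limit_density_measurable [measurable]: "limit_density \<rho> \<nu> \<alpha> \<beta> \<in> borel_measurable borel"
  unfolding limit_density_eq[abs_def] gamma_w_def by measurable

text \<open>The arc from \<open>arcsin u\<close> to \<open>pi - arcsin u\<close> gives the first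
  summand of the density. The mirror band contributes, after \<open>k\<close> is replaced by
  \<open>- k\<close>, the arc from \<open>- pi - arcsin u\<close> to \<open>arcsin u\<close>.
  Joined, they form a full period, which periodicity moves to the stated interval.\<close>

lemma limit_density_integral:
  "integrable lborel (\<lambda>y. limit_density \<rho> \<nu> \<alpha> \<beta> y *\<^sub>R cis (\<xi> * y))"
  "(\<integral>y. limit_density \<rho> \<nu> \<alpha> \<beta> y *\<^sub>R cis (\<xi> * y) \<partial>lborel)
     = integral {- (pi / 2)..- (pi / 2) + 2 * pi} (\<lambda>k. tilted \<xi> (vel k)) / of_real (2 * pi)"
proof -
  obtain u where u: "-1 < u" "u < 1" "crit u = 0" by (rule crit_root)
  have u': "-1 < - u" "- u < 1" "mirror.crit (- u) = 0" using u by (simp_all add: mirror_eq)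
  let ?f = "\<lambda>k. tilted \<xi> (vel k)" and ?a = "arcsin u"
  have cf: "continuous_on A ?f" for A
    by (rule continuous_on_compose_UNIV[OF continuous_tilted continuous_on_vel])
  have int: "?f integrable_on {x..y}" for x y
    by (intro integrable_continuous_real cf)
  have a: "- (pi / 2) \<le> ?a" "?a \<le> pi / 2" using u arcsin_lbound[of u] arcsin_ubound[of u] by simp_all
  note P = integral_push_density[OF u continuous_tilted, of \<xi>]
  note M = mirror.integral_push_density[OF u' continuous_tilted, of \<xi>]
  have eq: "limit_density \<rho> \<nu> \<alpha> \<beta> y *\<^sub>R cis (\<xi> * y)
      = (push_density y *\<^sub>R tilted \<xi> y + mirror.push_density y *\<^sub>R tilted \<xi> y) / of_real (2 * pi)" for y
    by (simp add: limit_density_eq scaleR_conv_of_real field_simps)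
  show "integrable lborel (\<lambda>y. limit_density \<rho> \<nu> \<alpha> \<beta> y *\<^sub>R cis (\<xi> * y))"
    unfolding eq by (intro Bochner_Integration.integrable_add integrable_divide P M)
  have "integral {arcsin (- u)..pi - arcsin (- u)} (\<lambda>k. tilted \<xi> (mirror.vel k))
      = integral {- ?a..pi + ?a} (\<lambda>k. ?f (0 - k))"
    using u by (simp add: mirror_eq arcsin_minus)
  also have "\<dots> = integral {- pi - ?a..?a} ?f"
    using integral_reflect_about[of 0 ?a "- pi - ?a" ?f] by (simp add: add.commute)
  finally have m: "integral {arcsin (- u)..pi - arcsin (- u)} (\<lambda>k. tilted \<xi> (mirror.vel k))
      = integral {- pi - ?a..?a} ?f" .
  have "(\<integral>y. limit_density \<rho> \<nu> \<alpha> \<beta> y *\<^sub>R cis (\<xi> * y) \<partial>lborel)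
      = (integral {?a..pi - ?a} ?f + integral {- pi - ?a..?a} ?f) / of_real (2 * pi)"
    unfolding eq using P M m by simp
  also have "integral {?a..pi - ?a} ?f + integral {- pi - ?a..?a} ?f = integral {- pi - ?a..pi - ?a} ?f"
    using Henstock_Kurzweil_Integration.integral_combine[of "- pi - ?a" ?a "pi - ?a" ?f] a int
    by (simp add: add.commute)
  also have "\<dots> = integral {- (pi / 2)..- (pi / 2) + 2 * pi} ?f"
    using integral_periodic[of ?f "2 * pi" "- pi - ?a" "- (pi / 2)"] cf a
    by (simp add: vel_def sphase_def)
  finally show "(\<integral>y. limit_density \<rho> \<nu> \<alpha> \<beta> y *\<^sub>R cis (\<xi> * y) \<partial>lborel)
     = integral {- (pi / 2)..- (pi / 2) + 2 * pi} (\<lambda>k. tilted \<xi> (vel k)) / of_real (2 * pi)" .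
qed

definition limit_law :: "real measure" where
  "limit_law = density lborel (limit_density \<rho> \<nu> \<alpha> \<beta>)"

text \<open>The total mass is found without evaluating the integral: at \<open>\<xi> = 0\<close>
  every sum in \<open>char_tendsto\<close> equals 1, hence so does the limit.\<close>

lemma limit_law_integral_one: "integrable lborel (limit_density \<rho> \<nu> \<alpha> \<beta>)" "(\<integral>y. limit_density \<rho> \<nu> \<alpha> \<beta> y \<partial>lborel) = 1"
proof -
  have c: "(\<lambda>y. limit_density \<rho> \<nu> \<alpha> \<beta> y *\<^sub>R cis (0 * y)) = (\<lambda>y. complex_of_real (limit_density \<rho> \<nu> \<alpha> \<beta> y))"
    by (simp add: scaleR_conv_of_real)
  show "integrable lborel (limit_density \<rho> \<nu> \<alpha> \<beta>)"
    using integrable_Re[OF limit_density_integral(1)[of 0]] unfolding c by simp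
  have "(\<lambda>t. complex_of_real (\<Sum>x\<in>{- int t..int t}. prob_at \<rho> \<nu> \<alpha> \<beta> t x)) \<longlonglongrightarrow>
      (\<integral>y. limit_density \<rho> \<nu> \<alpha> \<beta> y *\<^sub>R cis (0 * y) \<partial>lborel)"
    using char_tendsto[of 0] unfolding limit_density_integral(2) by simp
  then have "(\<lambda>t. 1) \<longlonglongrightarrow> complex_of_real (\<integral>y. limit_density \<rho> \<nu> \<alpha> \<beta> y \<partial>lborel)"
    unfolding c sum_prob_at by simp
  from LIMSEQ_unique[OF this tendsto_const]
  show "(\<integral>y. limit_density \<rho> \<nu> \<alpha> \<beta> y \<partial>lborel) = 1" using of_real_eq_1_iff by blast
qed

lemma real_distribution_limit_law: "real_distribution limit_law"
proof -
  have "emeasure limit_law (space limit_law) = 1"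
    unfolding limit_law_def using limit_law_integral_one
    by (simp add: emeasure_density nn_integral_eq_integral limit_density_nonneg)
  then have "prob_space limit_law" by (rule prob_spaceI)
  then show ?thesis
    by (simp add: real_distribution_def real_distribution_axioms_def limit_law_def)
qed

lemma measure_limit_law:
  assumes [measurable]: "A \<in> sets borel"
  shows "measure limit_law A = (LINT y:A|lborel. limit_density \<rho> \<nu> \<alpha> \<beta> y)"
proof -
  have "emeasure limit_law A = (\<integral>\<^sup>+y. ennreal (indicator A y * limit_density \<rho> \<nu> \<alpha> \<beta> y) \<partial>lborel)"
    unfolding limit_law_def by (subst emeasure_density) (auto intro!: nn_integral_cong split: split_indicator)
  also have "\<dots> = ennreal (\<integral>y. indicator A y * limit_density \<rho> \<nu> \<alpha> \<beta> y \<partial>lborel)"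
    using integrable_real_mult_indicator[OF _ limit_law_integral_one(1), of A]
    by (intro nn_integral_eq_integral) (auto simp: limit_density_nonneg mult.commute)
  finally show ?thesis
    unfolding measure_def set_lebesgue_integral_def
    by (simp add: limit_density_nonneg Bochner_Integration.integral_nonneg)
qed

section \<open>Laws of the rescaled position and Levy continuity\<close>

definition position :: "nat \<Rightarrow> int pmf" where
  "position t = embed_pmf (prob_at \<rho> \<nu> \<alpha> \<beta> t)"

lemma pmf_position: "pmf (position t) x = prob_at \<rho> \<nu> \<alpha> \<beta> t x"
  unfolding position_def
proof (rule pmf_embed_pmf[OF prob_at_nonneg])
  have "(\<integral>\<^sup>+x. ennreal (prob_at \<rho> \<nu> \<alpha> \<beta> t x) \<partial>count_space UNIV)
      = (\<Sum>x\<in>{- int t..int t}. ennreal (prob_at \<rho> \<nu> \<alpha> \<beta> t x))"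
    using prob_at_support by (intro nn_integral_count_space') auto
  also have "\<dots> = 1" using sum_prob_at[of t] by (simp add: sum_ennreal prob_at_nonneg)
  finally show "(\<integral>\<^sup>+x. ennreal (prob_at \<rho> \<nu> \<alpha> \<beta> t x) \<partial>count_space UNIV) = 1" .
qed

lemma set_pmf_position: "set_pmf (position t) \<subseteq> {- int t..int t}"
  using prob_at_support[of _ t] unfolding set_pmf_eq pmf_position by blast

text \<open>At \<open>t = 0\<close> the quotient is 0 by convention, so this is a probability law
  for every \<open>t\<close>, as \<open>levy_continuity\<close> asks.\<close>

definition scaled_law :: "nat \<Rightarrow> real measure" where
  "scaled_law t = distr (measure_pmf (position t)) borel (\<lambda>y. real_of_int y / real t)"

lemma char_scaled_law:
  "char (scaled_law t) \<xi> = (\<Sum>x\<in>{- int t..int t}. of_real (prob_at \<rho> \<nu> \<alpha> \<beta> t x) * cis (\<xi> / real t * of_int x))"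
proof -
  have "char (scaled_law t) \<xi> = (\<integral>x. cis (\<xi> * (real_of_int x / real t)) \<partial>measure_pmf (position t))"
    unfolding char_def scaled_law_def by (subst integral_distr) (auto simp: cis_conv_exp)
  also have "\<dots> = (\<Sum>x\<in>{- int t..int t}. pmf (position t) x *\<^sub>R cis (\<xi> * (real_of_int x / real t)))"
    using set_pmf_position[of t] by (intro integral_measure_pmf) auto
  finally show ?thesis by (simp add: pmf_position scaleR_conv_of_real)
qed

lemma cdf_scaled_eq: "cdf_scaled \<rho> \<nu> \<alpha> \<beta> t x = cdf (scaled_law t) x"
proof -
  let ?S = "{y::int. real_of_int y / real t \<le> x}" and ?A = "{- int t..int t}"
  have "cdf (scaled_law t) x = measure (measure_pmf (position t)) ?S"
    unfolding cdf_def scaled_law_def by (subst measure_distr) (auto simp: vimage_def)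
  also have "\<dots> = measure (measure_pmf (position t)) (?S \<inter> ?A)"
    using set_pmf_position[of t] by (intro measure_eq_AE) (auto simp: AE_measure_pmf_iff)
  also have "\<dots> = sum (prob_at \<rho> \<nu> \<alpha> \<beta> t) (?S \<inter> ?A)"
    by (subst measure_measure_pmf_finite) (auto simp: pmf_position)
  also have "\<dots> = infsum (prob_at \<rho> \<nu> \<alpha> \<beta> t) (?S \<inter> ?A)" by simp
  also have "\<dots> = infsum (prob_at \<rho> \<nu> \<alpha> \<beta> t) ?S"
    using prob_at_support[of _ t] by (intro infsum_cong_neutral) auto
  finally show ?thesis by (simp add: cdf_scaled_def)
qed

lemma cdf_scaled_tendsto:
  "(\<lambda>t. cdf_scaled \<rho> \<nu> \<alpha> \<beta> t x) \<longlonglongrightarrow> (LINT y:{..x}|lborel. limit_density \<rho> \<nu> \<alpha> \<beta> y)"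
proof -
  interpret L: real_distribution limit_law by (rule real_distribution_limit_law)
  have "weak_conv_m scaled_law limit_law"
  proof (rule levy_continuity)
    show "real_distribution (scaled_law t)" for t
      unfolding scaled_law_def by (rule prob_space.real_distribution_distr) (auto intro: prob_space_measure_pmf)
    fix \<xi>
    have "char limit_law \<xi> = (\<integral>y. limit_density \<rho> \<nu> \<alpha> \<beta> y *\<^sub>R cis (\<xi> * y) \<partial>lborel)"
      unfolding char_def limit_law_def
      by (subst integral_density) (auto simp: limit_density_nonneg cis_conv_exp)
    then show "(\<lambda>t. char (scaled_law t) \<xi>) \<longlonglongrightarrow> char limit_law \<xi>"
      using char_tendsto[of \<xi>] by (simp add: char_scaled_law limit_density_integral(2))
  qed (rule real_distribution_limit_law)
  \<comment> \<open>The limit law has no atoms, so its distribution function is continuous and weak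
    convergence gives convergence at every \<open>x\<close>.\<close>
  moreover have "measure limit_law {x} = 0"
  proof -
    have "AE y in lborel. indicat_real {x} y *\<^sub>R limit_density \<rho> \<nu> \<alpha> \<beta> y = 0"
      using AE_lborel_singleton[of x] by eventually_elim auto
    then show ?thesis
      unfolding measure_limit_law[OF borel_singleton[OF sets.empty_sets]] set_lebesgue_integral_def
      by (rule integral_eq_zero_AE)
  qed
  ultimately have "(\<lambda>t. cdf (scaled_law t) x) \<longlonglongrightarrow> cdf limit_law x"
    unfolding weak_conv_m_def weak_conv_def using L.isCont_cdf by auto
  then show ?thesis by (simp add: cdf_scaled_eq cdf_def measure_limit_law)
qed

end

text \<open>The squares of \<rho> and \<open>rho0 \<rho>\<close> sum to 1, so their product is at
  most 1/2, with equality only for \<open>\<rho> = 1 / sqrt 2\<close>. In that case the excluded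
  angles are exactly those with \<open>\<bar>sin \<nu>\<bar> = 1\<close>.\<close>

lemma walk_gap:
  fixes \<rho> \<nu> :: real
  assumes "0 < \<rho>" "\<rho> < 1"
    and "\<forall>n::int. \<not> (\<rho> = 1 / sqrt 2 \<and> \<nu> = pi / 2 + real_of_int n * pi)"
  shows "\<rho> * rho0 \<rho> * (1 + \<bar>sin \<nu>\<bar>) < 1"
proof -
  have r2: "\<rho>\<^sup>2 < 1" using assms by (simp add: abs_square_less_1)
  have r: "0 < rho0 \<rho>" "(rho0 \<rho>)\<^sup>2 = 1 - \<rho>\<^sup>2" using r2 by (simp_all add: rho0_def)
  have sq: "(\<rho> - rho0 \<rho>)\<^sup>2 = 1 - 2 * (\<rho> * rho0 \<rho>)" using r by (simp add: power2_diff)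
  have p: "0 < \<rho> * rho0 \<rho>" using assms r by simp
  show ?thesis
  proof (cases "\<rho> = rho0 \<rho>")
    case False
    then have "2 * (\<rho> * rho0 \<rho>) < 1" using sq by (smt (verit) zero_less_power2)
    moreover have "\<rho> * rho0 \<rho> * (1 + \<bar>sin \<nu>\<bar>) \<le> \<rho> * rho0 \<rho> * 2"
      using p by (intro mult_left_mono) auto
    ultimately show ?thesis by linarith
  next
    case True
    then have "\<rho>\<^sup>2 = 1 / 2" using r(2) by simp
    then have half: "\<rho> = 1 / sqrt 2" "\<rho> * rho0 \<rho> = 1 / 2"
      using assms(1) True real_sqrt_unique[of \<rho> "1 / 2"] by (simp_all add: real_sqrt_divide power2_eq_square)
    have "\<bar>sin \<nu>\<bar> \<noteq> 1"
    proof
      assume "\<bar>sin \<nu>\<bar> = 1"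
      then have "(sin \<nu>)\<^sup>2 = 1" by (simp add: abs_square_eq_1)
      then have "cos \<nu> = 0" using sin_cos_squared_add[of \<nu>] by simp
      then obtain n where "odd n" "\<nu> = of_int n * (pi / 2)" by (auto simp: cos_zero_iff_int)
      then obtain m where "n = 2 * m + 1" by (auto elim: oddE)
      then have "\<nu> = pi / 2 + real_of_int m * pi" using \<open>\<nu> = of_int n * (pi / 2)\<close> by (simp add: field_simps)
      then show False using assms(3) half(1) by blast
    qed
    then have "\<bar>sin \<nu>\<bar> < 1" using abs_sin_le_one[of \<nu>] by linarith
    then show ?thesis unfolding half(2) by simp
  qed
qed

theorem theorem1:
  fixes \<rho> \<nu> :: real and \<alpha> \<beta> :: complex
  assumes "0 < \<rho>" and "\<rho> < 1"
    and "\<forall>n::int. \<not> (\<rho> = 1 / sqrt 2 \<and> \<nu> = pi / 2 + real_of_int n * pi)"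
    and "(cmod \<alpha>)\<^sup>2 + (cmod \<beta>)\<^sup>2 = 1"
  shows "\<forall>x::real. (\<lambda>t. cdf_scaled \<rho> \<nu> \<alpha> \<beta> t x) \<longlonglongrightarrow>
           (LINT y:{..x}|lborel. limit_density \<rho> \<nu> \<alpha> \<beta> y)"
proof -
  interpret walk \<rho> \<nu> \<alpha> \<beta>
    using assms walk_gap[OF assms(1-3)] by unfold_locales
  show ?thesis using cdf_scaled_tendsto by blast
qed

end
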